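(* Let $p$ be a prime and $B \subseteq \mathbb{R}/\mathbb{Z}$ a ball. Suppose $\psi : \mathbb{R}_{>0} \to \mathbb{R}_{>0}$ is monotonically decreasing and for all $s > 1$ there exists $c > 0$ such that $\psi(sn) > c\,\psi(n)$ for all sufficiently large $n$. Then $\mu_p\big(W_p(\psi, B)\big) \in \{0, 1\}$.
   Context: $\mu_p$ is the Haar probability measure on the $p$-adic integers $\mathbb{Z}_p$, and $|\cdot|_p$ the $p$-adic absolute value. For $n \in \mathbb{N}$, $F_n^B := \{(a,n) \in \mathbb{N}^2 : \gcd(a,n) = 1,\ p \nmid n,\ \tfrac{a}{n} + \mathbb{Z} \in B\}$. Then $W_p(\psi, B) := \{\alpha \in \mathbb{Z}_p : |n\alpha - a|_p < \psi(\max(|a|,|n|)) \text{ for infinitely many } n \in \mathbb{N} \text{ and } (a,n) \in F_n^B\}$. *)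

theory Defs
  imports "HOL-Probability.Probability" "HOL-Algebra.Ring"
begin

text \<open>The ring of \<open>p\<close>-adic integers as the inverse limit of the rings \<open>\<int>/p\<^sup>n\<int>\<close>: an element is a
  compatible sequence of least non-negative residues modulo \<open>p\<^sup>n\<close>.\<close>

definition Zp :: "nat \<Rightarrow> (nat \<Rightarrow> int) ring" where
  "Zp p =
    \<lparr>carrier = {x. \<forall>n. x n \<in> {0..<int p ^ n} \<and> x (Suc n) mod int p ^ n = x n},
     mult = (\<lambda>x y n. (x n * y n) mod int p ^ n),
     one = (\<lambda>n. 1 mod int p ^ n),
     zero = (\<lambda>n. 0),
     add = (\<lambda>x y n. (x n + y n) mod int p ^ n)\<rparr>"

text \<open>For \<open>x \<noteq> 0\<close> the exponent below is the largest \<open>n\<close> such that \<open>x\<close> vanishes modulo \<open>p\<^sup>n\<close>.\<close>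

definition padic_abs :: "nat \<Rightarrow> (nat \<Rightarrow> int) \<Rightarrow> real" where
  "padic_abs p x = (if x = \<zero>\<^bsub>Zp p\<^esub> then 0 else (1 / real p) ^ (GREATEST n. x n = 0))"

text \<open>The value outside the carrier is irrelevant; it is symmetric because the locale
  \<open>Metric_space\<close> asks for symmetry on the whole type.\<close>

definition padic_dist :: "nat \<Rightarrow> (nat \<Rightarrow> int) \<Rightarrow> (nat \<Rightarrow> int) \<Rightarrow> real" where
  "padic_dist p x y = (if x \<in> carrier (Zp p) \<and> y \<in> carrier (Zp p)
     then padic_abs p (x \<ominus>\<^bsub>Zp p\<^esub> y) else 0)"

definition padic_borel :: "nat \<Rightarrow> (nat \<Rightarrow> int) measure" where
  "padic_borel p = sigma (carrier (Zp p))
     {U. openin (Metric_space.mtopology (carrier (Zp p)) (padic_dist p)) U}"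

definition is_Haar_prob :: "nat \<Rightarrow> (nat \<Rightarrow> int) measure \<Rightarrow> bool" where
  "is_Haar_prob p \<mu> \<longleftrightarrow> prob_space \<mu> \<and> sets \<mu> = sets (padic_borel p) \<and>
     (\<forall>x\<in>carrier (Zp p). \<forall>A\<in>sets \<mu>. emeasure \<mu> ((\<lambda>y. x \<oplus>\<^bsub>Zp p\<^esub> y) ` A) = emeasure \<mu> A)"

definition mod1_rel :: "(real \<times> real) set" where
  "mod1_rel = {(x, y). x - y \<in> \<int>}"

definition RmodZ :: "real set set" where
  "RmodZ = UNIV // mod1_rel"

definition mod1 :: "real \<Rightarrow> real set" where
  "mod1 x = mod1_rel `` {x}"

text \<open>The metric on \<open>\<real>/\<int>\<close> is the quotient metric, that is, the distance between cosets; a ball has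
  positive radius and may be open or closed.\<close>

definition is_RmodZ_ball :: "real set set \<Rightarrow> bool" where
  "is_RmodZ_ball B \<longleftrightarrow> (\<exists>c\<in>RmodZ. \<exists>r>0.
     B = Metric_space.mball RmodZ setdist c r \<or> B = Metric_space.mcball RmodZ setdist c r)"

definition padic_F :: "nat \<Rightarrow> real set set \<Rightarrow> nat \<Rightarrow> (nat \<times> nat) set" where
  "padic_F p B n = {(a, n) | a. a > 0 \<and> n > 0 \<and> coprime a n \<and> \<not> p dvd n \<and> mod1 (real a / real n) \<in> B}"

text \<open>``Infinitely many'' counts pairs \<open>(a, n)\<close>. In \<open>Zp p\<close> the terms \<open>n\<alpha>\<close> and \<open>a\<close> are the
  multiples \<open>n \<cdot> \<alpha>\<close> and \<open>a \<cdot> 1\<close>.\<close>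

definition padic_W :: "nat \<Rightarrow> (real \<Rightarrow> real) \<Rightarrow> real set set \<Rightarrow> (nat \<Rightarrow> int) set" where
  "padic_W p \<psi> B = {\<alpha> \<in> carrier (Zp p). infinite {(a, n). (a, n) \<in> padic_F p B n \<and>
     padic_abs p ([n] \<cdot>\<^bsub>Zp p\<^esub> \<alpha> \<ominus>\<^bsub>Zp p\<^esub> [a] \<cdot>\<^bsub>Zp p\<^esub> \<one>\<^bsub>Zp p\<^esub>) < \<psi> (max (real a) (real n))}}"


lemma Zp_carrierD:
  assumes "x \<in> carrier (Zp p)"
  shows "0 \<le> x n" "x n < int p ^ n" "x (Suc n) mod int p ^ n = x n"
  using assms by (auto simp: Zp_def)

lemma Zp_compat:
  assumes "x \<in> carrier (Zp p)" "n \<le> m"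
  shows "x m mod int p ^ n = x n"
  using assms(2)
proof (induction m rule: dec_induct)
  case base
  then show ?case using Zp_carrierD[OF assms(1)] by simp
next
  case (step m)
  have "int p ^ n dvd int p ^ m" using step by (simp add: le_imp_power_dvd)
  then have "x (Suc m) mod int p ^ n = (x (Suc m) mod int p ^ m) mod int p ^ n"
    by (simp add: mod_mod_cancel)
  then show ?case using step Zp_carrierD(3)[OF assms(1)] by simp
qed

lemma Zp_residueI:
  assumes "p > 0" "\<And>n. y (Suc n) mod int p ^ n = y n mod int p ^ n"
  shows "(\<lambda>n. y n mod int p ^ n) \<in> carrier (Zp p)"
proof -
  have "y (Suc n) mod int p ^ Suc n mod int p ^ n = y n mod int p ^ n" for n
    using assms(2)[of n] by (simp only: mod_mod_cancel[OF le_imp_power_dvd[of n "Suc n"]])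
  then show ?thesis using assms(1) by (auto simp: Zp_def)
qed

lemma Zp_cring:
  assumes "p > 0"
  shows "cring (Zp p)"
proof (rule cringI)
  have add: "x \<oplus>\<^bsub>Zp p\<^esub> y \<in> carrier (Zp p)" if "x \<in> carrier (Zp p)" "y \<in> carrier (Zp p)" for x y
  proof -
    have "x \<oplus>\<^bsub>Zp p\<^esub> y = (\<lambda>n. (x n + y n) mod int p ^ n)" by (simp add: Zp_def)
    moreover have "(\<lambda>n. (x n + y n) mod int p ^ n) \<in> carrier (Zp p)"
    proof (rule Zp_residueI[OF assms])
      fix n
      show "(x (Suc n) + y (Suc n)) mod int p ^ n = (x n + y n) mod int p ^ n"
        unfolding mod_add_eq[of "x (Suc n)", symmetric]
          Zp_carrierD(3)[OF that(1)] Zp_carrierD(3)[OF that(2)] by (rule refl)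
    qed
    ultimately show ?thesis by simp
  qed
  have mult: "x \<otimes>\<^bsub>Zp p\<^esub> y \<in> carrier (Zp p)" if "x \<in> carrier (Zp p)" "y \<in> carrier (Zp p)" for x y
  proof -
    have "x \<otimes>\<^bsub>Zp p\<^esub> y = (\<lambda>n. (x n * y n) mod int p ^ n)" by (simp add: Zp_def)
    moreover have "(\<lambda>n. (x n * y n) mod int p ^ n) \<in> carrier (Zp p)"
    proof (rule Zp_residueI[OF assms])
      fix n
      show "(x (Suc n) * y (Suc n)) mod int p ^ n = (x n * y n) mod int p ^ n"
        unfolding mod_mult_eq[of "x (Suc n)", symmetric]
          Zp_carrierD(3)[OF that(1)] Zp_carrierD(3)[OF that(2)] by (rule refl)
    qed
    ultimately show ?thesis by simp
  qed
  have id: "x n mod int p ^ n = x n" if "x \<in> carrier (Zp p)" for x n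
    using Zp_carrierD[OF that] by simp
  have zero: "\<zero>\<^bsub>Zp p\<^esub> \<in> carrier (Zp p)" using assms by (simp add: Zp_def)
  have one: "\<one>\<^bsub>Zp p\<^esub> \<in> carrier (Zp p)"
    using Zp_residueI[of p "\<lambda>n. 1"] assms by (simp add: Zp_def)
  have inv: "\<exists>y\<in>carrier (Zp p). y \<oplus>\<^bsub>Zp p\<^esub> x = \<zero>\<^bsub>Zp p\<^esub>" if "x \<in> carrier (Zp p)" for x
  proof
    show "(\<lambda>n. (- x n) mod int p ^ n) \<in> carrier (Zp p)"
      using Zp_residueI[of p "\<lambda>n. - x n"] assms that Zp_carrierD(3) by (metis mod_minus_eq)
    show "(\<lambda>n. (- x n) mod int p ^ n) \<oplus>\<^bsub>Zp p\<^esub> x = \<zero>\<^bsub>Zp p\<^esub>"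
      by (simp add: Zp_def mod_add_left_eq)
  qed
  show "abelian_group (Zp p)"
    by (rule abelian_groupI)
      (use add zero inv in \<open>auto simp: Zp_def fun_eq_iff mod_simps algebra_simps\<close>)
  show "comm_monoid (Zp p)"
    by (rule comm_monoidI)
      (use mult one id in \<open>auto simp: Zp_def fun_eq_iff mod_simps algebra_simps\<close>)
  show "(x \<oplus>\<^bsub>Zp p\<^esub> y) \<otimes>\<^bsub>Zp p\<^esub> z = x \<otimes>\<^bsub>Zp p\<^esub> z \<oplus>\<^bsub>Zp p\<^esub> y \<otimes>\<^bsub>Zp p\<^esub> z" for x y z
    by (auto simp: Zp_def fun_eq_iff mod_simps algebra_simps)
qed

lemma Zp_minus:
  assumes "p > 0" "x \<in> carrier (Zp p)" "y \<in> carrier (Zp p)"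
  shows "(x \<ominus>\<^bsub>Zp p\<^esub> y) n = (x n - y n) mod int p ^ n"
proof -
  interpret cring "Zp p" using Zp_cring assms(1) .
  have z: "(x \<ominus>\<^bsub>Zp p\<^esub> y) \<in> carrier (Zp p)" using assms by simp
  have "(x \<ominus>\<^bsub>Zp p\<^esub> y) \<oplus>\<^bsub>Zp p\<^esub> y = x"
    using assms by (simp add: a_minus_def a_assoc l_neg)
  then have "((x \<ominus>\<^bsub>Zp p\<^esub> y) n + y n) mod int p ^ n = x n"
    by (auto simp: Zp_def fun_eq_iff)
  then have "(x n - y n) mod int p ^ n = (x \<ominus>\<^bsub>Zp p\<^esub> y) n mod int p ^ n"
    by (metis add_diff_cancel_right' mod_diff_left_eq)
  then show ?thesis using Zp_carrierD[OF z] by simp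
qed

lemma Zp_add_pow:
  fixes k :: nat
  shows "([k] \<cdot>\<^bsub>Zp p\<^esub> x) n = (int k * x n) mod int p ^ n"
  by (induction k) (auto simp: add_pow_def Zp_def nat_pow_def mod_simps algebra_simps)

lemma padic_abs_le_iff:
  assumes "p > 1" "x \<in> carrier (Zp p)"
  shows "padic_abs p x \<le> (1 / real p) ^ n \<longleftrightarrow> x n = 0"
proof (cases "x = \<zero>\<^bsub>Zp p\<^esub>")
  case True
  then show ?thesis by (simp add: padic_abs_def) (simp add: Zp_def)
next
  case False
  then obtain m where m: "x m \<noteq> 0" by (auto simp: Zp_def fun_eq_iff)
  have down: "x i = 0" if "x j = 0" "i \<le> j" for i j
    using Zp_compat[OF assms(2) that(2)] that(1) by simp
  have bound: "\<And>j. x j = 0 \<Longrightarrow> j \<le> m" using down m by (meson nat_le_linear)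
  have "x 0 = 0" using Zp_carrierD[OF assms(2), of 0] by simp
  then have g: "x (GREATEST n. x n = 0) = 0" using bound by (rule GreatestI_nat)
  have "x n = 0 \<longleftrightarrow> n \<le> (GREATEST n. x n = 0)"
    using g down bound Greatest_le_nat[of "\<lambda>n. x n = 0"] by blast
  moreover have "(1 / real p) ^ k \<le> (1 / real p) ^ n \<longleftrightarrow> n \<le> k" for k
    using assms(1) by (intro power_decreasing_iff) auto
  ultimately show ?thesis using False by (simp add: padic_abs_def)
qed

lemma padic_abs_of_nat:
  assumes "prime p" "a > 0"
  shows "padic_abs p ([a] \<cdot>\<^bsub>Zp p\<^esub> \<one>\<^bsub>Zp p\<^esub>) = (1 / real p) ^ multiplicity p a"
proof -
  have p: "p > 1" using assms(1) prime_gt_1_nat by blast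
  have eq: "([a] \<cdot>\<^bsub>Zp p\<^esub> \<one>\<^bsub>Zp p\<^esub>) n = 0 \<longleftrightarrow> n \<le> multiplicity p a" for n
  proof -
    have "([a] \<cdot>\<^bsub>Zp p\<^esub> \<one>\<^bsub>Zp p\<^esub>) n = int a mod int p ^ n"
      unfolding Zp_add_pow by (simp add: Zp_def mod_simps)
    also have "\<dots> = 0 \<longleftrightarrow> p ^ n dvd a"
      by (simp add: mod_eq_0_iff_dvd flip: of_nat_power)
    also have "\<dots> \<longleftrightarrow> n \<le> multiplicity p a"
      using assms p by (intro power_dvd_iff_le_multiplicity) (auto simp: not_prime_unit)
    finally show ?thesis .
  qed
  have "[a] \<cdot>\<^bsub>Zp p\<^esub> \<one>\<^bsub>Zp p\<^esub> \<noteq> \<zero>\<^bsub>Zp p\<^esub>"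
    using eq[of "Suc (multiplicity p a)"] by (auto simp: Zp_def)
  moreover have "(GREATEST n. n \<le> multiplicity p a) = multiplicity p a"
    by (rule Greatest_equality) auto
  ultimately show ?thesis unfolding padic_abs_def eq by simp
qed

lemma padic_dist_le_iff:
  assumes "p > 1" "x \<in> carrier (Zp p)" "y \<in> carrier (Zp p)"
  shows "padic_dist p x y \<le> (1 / real p) ^ n \<longleftrightarrow> x n = y n"
proof -
  interpret cring "Zp p" using Zp_cring assms(1) by simp
  have "padic_dist p x y \<le> (1 / real p) ^ n \<longleftrightarrow> (x n - y n) mod int p ^ n = 0"
    unfolding padic_dist_def using assms by (simp add: padic_abs_le_iff Zp_minus)
  also have "\<dots> \<longleftrightarrow> x n mod int p ^ n = y n mod int p ^ n"
    by (simp add: mod_eq_dvd_iff mod_eq_0_iff_dvd)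
  finally show ?thesis using Zp_carrierD[OF assms(2)] Zp_carrierD[OF assms(3)] by simp
qed

lemma padic_dist_cases:
  "padic_dist p x y = 0 \<or> (\<exists>n. padic_dist p x y = (1 / real p) ^ n)"
  by (auto simp: padic_dist_def padic_abs_def)

lemma padic_dist_0:
  assumes "p > 1" "x \<in> carrier (Zp p)" "y \<in> carrier (Zp p)"
  shows "padic_dist p x y = 0 \<longleftrightarrow> x = y"
proof
  assume "padic_dist p x y = 0"
  then have "x n = y n" for n using padic_dist_le_iff[OF assms, of n] by simp
  then show "x = y" ..
next
  assume "x = y"
  then have "x \<ominus>\<^bsub>Zp p\<^esub> y = \<zero>\<^bsub>Zp p\<^esub>"
    using Zp_minus[of p x y] assms by (auto simp: Zp_def)
  then show "padic_dist p x y = 0" by (simp add: padic_dist_def padic_abs_def)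
qed

lemma Metric_space_Zp:
  assumes "p > 1"
  shows "Metric_space (carrier (Zp p)) (padic_dist p)"
proof (rule Metric_space.intro)
  have nonneg: "0 \<le> padic_dist p x y" for x y by (simp add: padic_dist_def padic_abs_def)
  show "0 \<le> padic_dist p x y" for x y by (rule nonneg)
  show "padic_dist p x y = 0 \<longleftrightarrow> x = y" if "x \<in> carrier (Zp p)" "y \<in> carrier (Zp p)" for x y
    by (rule padic_dist_0) (use assms that in auto)
  interpret cring "Zp p" using Zp_cring assms by simp
  show "padic_dist p x z \<le> padic_dist p x y + padic_dist p y z"
    if xyz: "x \<in> carrier (Zp p)" "y \<in> carrier (Zp p)" "z \<in> carrier (Zp p)" for x y z
  proof -
    consider "x = y" | "y = z" | n m where "padic_dist p x y = (1 / real p) ^ n" "padic_dist p y z = (1 / real p) ^ m"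
      using padic_dist_cases[of p x y] padic_dist_cases[of p y z]
        padic_dist_0[OF assms xyz(1,2)] padic_dist_0[OF assms xyz(2,3)] by blast
    then show ?thesis
    proof cases
      case 3
      define k where "k = min n m"
      have "(1 / real p) ^ n \<le> (1 / real p) ^ k" "(1 / real p) ^ m \<le> (1 / real p) ^ k"
        using assms by (auto simp: k_def intro!: power_decreasing)
      then have "x k = z k" using padic_dist_le_iff[of p _ _ k] assms xyz 3 by metis
      then have "padic_dist p x z \<le> (1 / real p) ^ k"
        using padic_dist_le_iff[of p _ _ k] assms xyz by metis
      then show ?thesis using 3 nonneg by (auto simp: k_def min_def split: if_splits)
        (smt (verit) nonneg)+
    qed (use nonneg in auto)
  qed
  show "padic_dist p x y = padic_dist p y x" for x y
  proof (cases "x \<in> carrier (Zp p) \<and> y \<in> carrier (Zp p)")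
    case True
    then have xy: "x \<in> carrier (Zp p)" "y \<in> carrier (Zp p)" by auto
    have le: "padic_dist p v u \<le> padic_dist p u v"
      if "u \<in> carrier (Zp p)" "v \<in> carrier (Zp p)" for u v
      using padic_dist_cases[of p u v] padic_dist_le_iff[of p u v] padic_dist_le_iff[of p v u]
        padic_dist_0[of p u v] padic_dist_0[of p v u] assms that
      by (metis order_refl)
    show ?thesis using le[OF xy] le[OF xy(2,1)] by simp
  qed (auto simp: padic_dist_def)
qed


lemma Metric_space_RmodZ: "Metric_space RmodZ setdist"
proof (rule Metric_space.intro)
  show "0 \<le> setdist X Y" for X Y :: "real set" by (rule setdist_pos_le)
  show "setdist X Y = setdist Y X" for X Y :: "real set" by (rule setdist_sym)
  have rep: "\<exists>x. X = mod1 x" if "X \<in> RmodZ" for X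
    using that by (auto simp: RmodZ_def mod1_def quotient_def)
  have mem: "y \<in> mod1 x \<longleftrightarrow> (\<exists>k. y = x + of_int k)" for x y
  proof -
    have "y \<in> mod1 x \<longleftrightarrow> x - y \<in> \<int>" by (simp add: mod1_def mod1_rel_def)
    also have "\<dots> \<longleftrightarrow> (\<exists>k. y = x + of_int k)"
      by (metis Ints_minus Ints_of_int Ints_cases add_diff_cancel_left' diff_add_cancel minus_diff_eq add.commute)
    finally show ?thesis .
  qed
  have sd: "setdist (mod1 x) (mod1 y) = \<bar>x - y - of_int (round (x - y))\<bar>" for x y
  proof (rule antisym)
    have "setdist (mod1 x) (mod1 y) \<le> dist (x + of_int 0) (y + of_int (round (x - y)))"
      by (rule setdist_le_dist) (use mem in blast)+
    then show "setdist (mod1 x) (mod1 y) \<le> \<bar>x - y - of_int (round (x - y))\<bar>"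
      by (simp add: dist_real_def algebra_simps)
    show "\<bar>x - y - of_int (round (x - y))\<bar> \<le> setdist (mod1 x) (mod1 y)"
    proof (rule le_setdistI)
      show "mod1 x \<noteq> {}" "mod1 y \<noteq> {}" using mem by blast+
      fix u v assume "u \<in> mod1 x" "v \<in> mod1 y"
      then obtain k l where "u = x + of_int k" "v = y + of_int l" using mem by blast
      then have "dist u v = \<bar>(x - y) - of_int (l - k)\<bar>" by (simp add: dist_real_def)
      then show "\<bar>x - y - of_int (round (x - y))\<bar> \<le> dist u v"
        using round_diff_minimal[of "x - y" "l - k"] by simp
    qed
  qed
  show "setdist X Y = 0 \<longleftrightarrow> X = Y" if XY: "X \<in> RmodZ" "Y \<in> RmodZ" for X Y
  proof -
    obtain x y where xy: "X = mod1 x" "Y = mod1 y" using rep XY by metis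
    have "X = Y" if "setdist X Y = 0"
    proof -
      have x: "x = y + of_int (round (x - y))" using that xy sd[of x y] by simp
      have "\<exists>j. z = y + of_int j" if "z = x + of_int k" for z k
        using that x by (intro exI[of _ "round (x - y) + k"]) simp
      moreover have "\<exists>j. z = x + of_int j" if "z = y + of_int k" for z k
        using that x by (intro exI[of _ "k - round (x - y)"]) simp
      ultimately show ?thesis unfolding xy set_eq_iff mem by blast
    qed
    then show ?thesis using sd[of x x] xy by auto
  qed
  show "setdist X Z \<le> setdist X Y + setdist Y Z"
    if XYZ: "X \<in> RmodZ" "Y \<in> RmodZ" "Z \<in> RmodZ" for X Y Z
  proof -
    obtain x y z where xyz: "X = mod1 x" "Y = mod1 y" "Z = mod1 z" using rep XYZ by metis
    have "\<bar>x - z - of_int (round (x - z))\<bar>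
        \<le> \<bar>x - z - of_int (round (x - y) + round (y - z))\<bar>"
      by (rule round_diff_minimal)
    also have "\<dots> \<le> \<bar>x - y - of_int (round (x - y))\<bar> + \<bar>y - z - of_int (round (y - z))\<bar>"
      by simp
    finally show ?thesis by (simp add: xyz sd)
  qed
qed

definition Zp_cylinder :: "nat \<Rightarrow> nat \<Rightarrow> int \<Rightarrow> (nat \<Rightarrow> int) set" where
  "Zp_cylinder p n r = {x \<in> carrier (Zp p). x n = r}"

definition Zp_cylinders :: "nat \<Rightarrow> (nat \<Rightarrow> int) set set" where
  "Zp_cylinders p = insert {} {Zp_cylinder p n r | n r. True}"

lemma Zp_cylinder_0: "Zp_cylinder p 0 0 = carrier (Zp p)"
  using Zp_carrierD[of _ p 0] by (force simp: Zp_cylinder_def)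

lemma Zp_cylinders_Pow: "Zp_cylinders p \<subseteq> Pow (carrier (Zp p))"
  by (auto simp: Zp_cylinders_def Zp_cylinder_def)

lemma Zp_cylinders_Int_stable: "Int_stable (Zp_cylinders p)"
proof (rule Int_stableI)
  have le: "Zp_cylinder p n r \<inter> Zp_cylinder p m s \<in> Zp_cylinders p" if "n \<le> m" for n r m s
  proof (cases "s mod int p ^ n = r")
    case True
    then have "Zp_cylinder p n r \<inter> Zp_cylinder p m s = Zp_cylinder p m s"
      using Zp_compat[OF _ that] by (auto simp: Zp_cylinder_def)
    then show ?thesis by (auto simp: Zp_cylinders_def)
  next
    case False
    then have "Zp_cylinder p n r \<inter> Zp_cylinder p m s = {}"
      using Zp_compat[OF _ that] by (auto simp: Zp_cylinder_def)
    then show ?thesis by (simp add: Zp_cylinders_def)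
  qed
  fix A B assume "A \<in> Zp_cylinders p" "B \<in> Zp_cylinders p"
  then consider "A = {}" | "B = {}" | n r m s where "A = Zp_cylinder p n r" "B = Zp_cylinder p m s"
    by (auto simp: Zp_cylinders_def)
  then show "A \<inter> B \<in> Zp_cylinders p"
  proof cases
    case 3
    then show ?thesis using le[of n m r s] le[of m n s r]
      by (metis Int_commute nat_le_linear)
  qed (simp_all add: Zp_cylinders_def)
qed

lemma openin_Zp_iff:
  assumes "p > 1"
  shows "openin (Metric_space.mtopology (carrier (Zp p)) (padic_dist p)) U \<longleftrightarrow>
    U \<subseteq> carrier (Zp p) \<and> (\<forall>x\<in>U. \<exists>n. Zp_cylinder p n (x n) \<subseteq> U)"
proof -
  interpret Metric_space "carrier (Zp p)" "padic_dist p" using Metric_space_Zp[OF assms] .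
  have "(\<exists>r>0. mball x r \<subseteq> U) \<longleftrightarrow> (\<exists>n. Zp_cylinder p n (x n) \<subseteq> U)"
    if x: "x \<in> carrier (Zp p)" for x
  proof
    assume "\<exists>r>0. mball x r \<subseteq> U"
    then obtain r where r: "r > 0" "mball x r \<subseteq> U" by blast
    obtain n where "(1 / real p) ^ n < r"
      using real_arch_pow_inv[of r "1 / real p"] r assms by auto
    moreover have "padic_dist p x y \<le> (1 / real p) ^ n" if "y \<in> Zp_cylinder p n (x n)" for y
      using that padic_dist_le_iff[OF assms x, of y n] by (simp add: Zp_cylinder_def)
    ultimately have "Zp_cylinder p n (x n) \<subseteq> mball x r"
      using x by (force simp: Zp_cylinder_def)
    then show "\<exists>n. Zp_cylinder p n (x n) \<subseteq> U" using r by blast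
  next
    assume "\<exists>n. Zp_cylinder p n (x n) \<subseteq> U"
    then obtain n where n: "Zp_cylinder p n (x n) \<subseteq> U" by blast
    have "mball x ((1 / real p) ^ n) \<subseteq> Zp_cylinder p n (x n)"
      using padic_dist_le_iff[OF assms x] by (auto simp: Zp_cylinder_def dest!: less_imp_le)
    then show "\<exists>r>0. mball x r \<subseteq> U" using n assms
      by (intro exI[of _ "(1 / real p) ^ n"]) auto
  qed
  then show ?thesis unfolding openin_mtopology by blast
qed

lemma sets_padic_borel:
  assumes "p > 1"
  shows "sets (padic_borel p) = sigma_sets (carrier (Zp p)) (Zp_cylinders p)"
proof -
  let ?C = "carrier (Zp p)"
  let ?O = "{U. openin (Metric_space.mtopology ?C (padic_dist p)) U}"
  have "?O \<subseteq> Pow ?C" by (auto simp: openin_Zp_iff[OF assms])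
  then have "sets (padic_borel p) = sigma_sets ?C ?O" by (simp add: padic_borel_def)
  also have "\<dots> = sigma_sets ?C (Zp_cylinders p)"
  proof (rule sigma_sets_eqI)
    fix U assume "U \<in> Zp_cylinders p"
    then have "U \<in> ?O" by (auto simp: openin_Zp_iff[OF assms] Zp_cylinders_def Zp_cylinder_def)
    then show "U \<in> sigma_sets ?C ?O" by (rule sigma_sets.Basic)
  next
    fix U assume "U \<in> ?O"
    then have U: "U \<subseteq> ?C" "\<forall>x\<in>U. \<exists>n. Zp_cylinder p n (x n) \<subseteq> U"
      by (auto simp: openin_Zp_iff[OF assms])
    define D where "D = {C \<in> Zp_cylinders p. C \<subseteq> U}"
    have "Zp_cylinders p = insert {} ((\<lambda>(n, r). Zp_cylinder p n r) ` UNIV)"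
      by (auto simp: Zp_cylinders_def)
    then have "countable (Zp_cylinders p)" by simp
    then have "countable D" by (rule countable_subset[rotated]) (auto simp: D_def)
    interpret sigma_algebra ?C "sigma_sets ?C (Zp_cylinders p)"
      by (rule sigma_algebra_sigma_sets) (rule Zp_cylinders_Pow)
    have "\<Union>D \<in> sigma_sets ?C (Zp_cylinders p)"
      by (rule countable_Union) (use \<open>countable D\<close> in \<open>auto simp: D_def\<close>)
    moreover have "\<Union>D = U"
    proof
      show "U \<subseteq> \<Union>D"
      proof
        fix x assume x: "x \<in> U"
        then obtain n where "Zp_cylinder p n (x n) \<subseteq> U" using U by blast
        then have "Zp_cylinder p n (x n) \<in> D" by (auto simp: D_def Zp_cylinders_def)
        moreover have "x \<in> Zp_cylinder p n (x n)" using x U by (auto simp: Zp_cylinder_def)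
        ultimately show "x \<in> \<Union>D" by blast
      qed
    qed (auto simp: D_def)
    ultimately show "U \<in> sigma_sets ?C (Zp_cylinders p)" by simp
  qed
  finally show ?thesis .
qed

lemma space_padic_borel: "space (padic_borel p) = carrier (Zp p)"
  unfolding padic_borel_def by (rule space_measure_of_conv)

definition digits_int :: "nat \<Rightarrow> (nat \<Rightarrow> nat) \<Rightarrow> nat \<Rightarrow> int" where
  "digits_int p d n = (\<Sum>i<n. int (d i) * int p ^ i)"

lemma digits_int_bound:
  assumes "\<And>i. d i < p"
  shows "0 \<le> digits_int p d n" "digits_int p d n < int p ^ n"
proof -
  show "0 \<le> digits_int p d n" by (simp add: digits_int_def sum_nonneg)
  show "digits_int p d n < int p ^ n"
  proof (induction n)
    case (Suc n)
    have "int (d n) * int p ^ n \<le> (int p - 1) * int p ^ n"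
      using assms[of n] by (intro mult_right_mono) auto
    then show ?case using Suc by (simp add: digits_int_def algebra_simps)
  qed (simp add: digits_int_def)
qed

lemma digits_int_carrier:
  assumes "\<And>i. d i < p"
  shows "digits_int p d \<in> carrier (Zp p)"
proof -
  have "digits_int p d (Suc n) mod int p ^ n = digits_int p d n" for n
    using digits_int_bound[of d p n] assms by (simp add: digits_int_def)
  then show ?thesis using digits_int_bound[of d p] assms by (simp add: Zp_def)
qed

lemma digits_int_eq:
  assumes "0 \<le> r" "r < int p ^ n"
  shows "\<exists>e. (\<forall>i<n. e i < p) \<and>
    (\<forall>d. (\<forall>i. d i < p) \<longrightarrow> (digits_int p d n = r \<longleftrightarrow> (\<forall>i<n. d i = e i)))"
  using assms
proof (induction n arbitrary: r)
  case 0
  then show ?case by (simp add: digits_int_def)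
next
  case (Suc n)
  have p: "int p ^ n > 0" using Suc.prems by (cases p) (auto simp: power_0_left split: if_splits)
  have "0 \<le> r mod int p ^ n" "r mod int p ^ n < int p ^ n" using p by auto
  from Suc.IH[OF this] obtain e where e: "\<forall>i<n. e i < p"
    "\<And>d. (\<forall>i. d i < p) \<Longrightarrow> (digits_int p d n = r mod int p ^ n \<longleftrightarrow> (\<forall>i<n. d i = e i))"
    by blast
  define q where "q = nat (r div int p ^ n)"
  have q: "int q = r div int p ^ n"
    using p Suc.prems by (simp add: q_def pos_imp_zdiv_nonneg_iff)
  have "q < p"
  proof -
    have "int q * int p ^ n \<le> r"
      using q p Suc.prems by (metis div_mult_mod_eq le_add_same_cancel1 pos_mod_sign)
    also have "r < int p * int p ^ n" using Suc.prems by simp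
    finally show ?thesis using p by simp
  qed
  have "digits_int p d (Suc n) = r \<longleftrightarrow> (\<forall>i<Suc n. d i = (e(n := q)) i)"
    if d: "\<forall>i. d i < p" for d
  proof -
    have b: "0 \<le> digits_int p d n" "digits_int p d n < int p ^ n"
      using digits_int_bound d by auto
    have s: "digits_int p d (Suc n) = digits_int p d n + int (d n) * int p ^ n"
      by (simp add: digits_int_def)
    have "digits_int p d (Suc n) = r \<longleftrightarrow> digits_int p d n = r mod int p ^ n \<and> int (d n) = r div int p ^ n"
    proof
      assume "digits_int p d (Suc n) = r"
      then have "r = digits_int p d n + int (d n) * int p ^ n" using s by simp
      then show "digits_int p d n = r mod int p ^ n \<and> int (d n) = r div int p ^ n"
        using b p by simp
    next
      assume "digits_int p d n = r mod int p ^ n \<and> int (d n) = r div int p ^ n"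
      then show "digits_int p d (Suc n) = r" using s by (simp add: mod_div_mult_eq)
    qed
    also have "\<dots> \<longleftrightarrow> (\<forall>i<n. d i = e i) \<and> d n = q"
      using e(2)[OF d] q by (metis of_nat_eq_iff)
    also have "\<dots> \<longleftrightarrow> (\<forall>i<Suc n. d i = (e(n := q)) i)"
      by (auto simp: less_Suc_eq)
    finally show ?thesis .
  qed
  moreover have "\<forall>i<Suc n. (e(n := q)) i < p" using e(1) \<open>q < p\<close> by (auto simp: less_Suc_eq)
  ultimately show ?case by blast
qed

lemma Zp_cylinder_translate:
  assumes "p > 0" "a \<in> carrier (Zp p)" "0 \<le> r" "r < int p ^ n"
  shows "(\<lambda>z. z \<ominus>\<^bsub>Zp p\<^esub> a) -` Zp_cylinder p n r \<inter> carrier (Zp p)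
    = Zp_cylinder p n ((r + a n) mod int p ^ n)"
proof -
  interpret cring "Zp p" using Zp_cring assms(1) .
  have "(z n - a n) mod int p ^ n = r \<longleftrightarrow> z n = (r + a n) mod int p ^ n"
    if z: "z \<in> carrier (Zp p)" for z
  proof -
    have "(z n - a n) mod int p ^ n = r \<longleftrightarrow> (z n - a n) mod int p ^ n = r mod int p ^ n"
      using assms by simp
    also have "\<dots> \<longleftrightarrow> z n mod int p ^ n = (r + a n) mod int p ^ n"
      by (simp add: mod_eq_dvd_iff algebra_simps)
    finally show ?thesis using Zp_carrierD[OF z] by simp
  qed
  moreover have "z \<ominus>\<^bsub>Zp p\<^esub> a \<in> Zp_cylinder p n r \<longleftrightarrow> (z n - a n) mod int p ^ n = r"
    if "z \<in> carrier (Zp p)" for z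
    using that assms(1,2) by (simp add: Zp_cylinder_def Zp_minus)
  ultimately show ?thesis unfolding Zp_cylinder_def[of _ _ "_ mod _"] by blast
qed

text \<open>Existence of the Haar probability measure: take independent uniform digits.\<close>

lemma ex_Haar_prob:
  assumes "p > 1"
  shows "\<exists>\<mu>. is_Haar_prob p \<mu>"
proof -
  let ?C = "carrier (Zp p)"
  interpret cring "Zp p" using Zp_cring assms by simp
  define U where "U = uniform_count_measure {..<p}"
  define N where "N = PiM (UNIV :: nat set) (\<lambda>_. U)"
  have ne: "{..<p} \<noteq> {}" using assms by (auto simp: lessThan_empty_iff)
  have U: "prob_space U" unfolding U_def
    by (rule prob_space_uniform_count_measure[OF finite_lessThan ne])
  have "product_prob_space (\<lambda>_::nat. U)"
    by (rule product_prob_spaceI) (rule U)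
  then interpret N: product_prob_space "\<lambda>_. U" "UNIV :: nat set" .
  have spU: "space U = {..<p}" "sets U = Pow {..<p}"
    by (simp_all add: U_def space_uniform_count_measure sets_uniform_count_measure)
  have spN: "d \<in> space N \<longleftrightarrow> (\<forall>i. d i < p)" for d
    by (auto simp: N_def space_PiM spU PiE_def Pi_def)
  have cyl: "{d \<in> space N. digits_int p d n = r} \<in> sets N \<and>
      emeasure N {d \<in> space N. digits_int p d n = r} = (\<Prod>i<n. ennreal (1 / real p))"
    if r: "0 \<le> r" "r < int p ^ n" for n r
  proof -
    obtain e where e: "\<forall>i<n. e i < p"
      "\<And>d. (\<forall>i. d i < p) \<Longrightarrow> (digits_int p d n = r \<longleftrightarrow> (\<forall>i<n. d i = e i))"
      using digits_int_eq[OF r] by blast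
    have eq: "{d \<in> space N. digits_int p d n = r} = {d \<in> space N. \<forall>i\<in>{..<n}. d i \<in> {e i}}"
      using e(2) by (auto simp: spN)
    have "emeasure N {d \<in> space N. \<forall>i\<in>{..<n}. d i \<in> {e i}} = (\<Prod>i<n. emeasure U {e i})"
      unfolding N_def by (rule N.emeasure_PiM_Collect) (use e spU in auto)
    also have "\<dots> = (\<Prod>i<n. ennreal (1 / real p))"
      using e(1) by (intro prod.cong) (auto simp: U_def emeasure_uniform_count_measure)
    finally have "emeasure N {d \<in> space N. digits_int p d n = r} = (\<Prod>i<n. ennreal (1 / real p))"
      using eq by simp
    moreover from this have "emeasure N {d \<in> space N. digits_int p d n = r} \<noteq> 0"
      using assms by (simp add: ennreal_eq_0_iff)
    then have "{d \<in> space N. digits_int p d n = r} \<in> sets N"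
      using emeasure_notin_sets by blast
    ultimately show ?thesis by blast
  qed
  have empty: "Zp_cylinder p n r = {}" if "\<not> (0 \<le> r \<and> r < int p ^ n)" for n r
    using that Zp_carrierD by (auto simp: Zp_cylinder_def)
  have cylE: "A = {} \<or> (\<exists>n r. A = Zp_cylinder p n r \<and> 0 \<le> r \<and> r < int p ^ n)"
    if A: "A \<in> Zp_cylinders p" for A
  proof (cases "A = {}")
    case False
    then obtain n r where "A = Zp_cylinder p n r" using A by (auto simp: Zp_cylinders_def)
    then show ?thesis using empty[of r n] False by blast
  qed simp
  have gen: "sets (padic_borel p) = sets (sigma ?C (Zp_cylinders p))"
    using sets_padic_borel[OF assms] Zp_cylinders_Pow by simp
  have meas_gen: "f \<in> M \<rightarrow>\<^sub>M padic_borel p"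
    if f: "f \<in> space M \<rightarrow> ?C"
      "\<And>n r. 0 \<le> r \<Longrightarrow> r < int p ^ n \<Longrightarrow> f -` Zp_cylinder p n r \<inter> space M \<in> sets M"
    for f and M :: "'b measure"
  proof -
    have "f \<in> M \<rightarrow>\<^sub>M sigma ?C (Zp_cylinders p)"
    proof (rule measurable_measure_of[OF Zp_cylinders_Pow f(1)])
      fix A assume "A \<in> Zp_cylinders p"
      then consider "A = {}" | n r where "A = Zp_cylinder p n r" "0 \<le> r" "r < int p ^ n"
        using cylE by blast
      then show "f -` A \<inter> space M \<in> sets M" by cases (use f(2) in auto)
    qed
    then show ?thesis using measurable_cong_sets[OF refl gen] by blast
  qed
  have vim: "digits_int p -` Zp_cylinder p n r \<inter> space N = {d \<in> space N. digits_int p d n = r}" for n r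
    using digits_int_carrier by (auto simp: Zp_cylinder_def spN)
  have f: "digits_int p \<in> N \<rightarrow>\<^sub>M padic_borel p"
    by (rule meas_gen) (use digits_int_carrier cyl vim in \<open>auto simp: spN\<close>)
  define \<mu> where "\<mu> = distr N (padic_borel p) (digits_int p)"
  have sets: "sets \<mu> = sets (padic_borel p)" by (simp add: \<mu>_def)
  have space: "space \<mu> = ?C" by (simp add: \<mu>_def space_padic_borel)
  have cyl_sets: "Zp_cylinder p n r \<in> sets (padic_borel p)" for n r
    unfolding sets_padic_borel[OF assms] by (rule sigma_sets.Basic) (auto simp: Zp_cylinders_def)
  have cyl_emeasure: "emeasure \<mu> (Zp_cylinder p n r) = (\<Prod>i<n. ennreal (1 / real p))"
    if "0 \<le> r" "r < int p ^ n" for n r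
    unfolding \<mu>_def using cyl[OF that] f cyl_sets by (simp add: emeasure_distr vim)
  have prob: "prob_space \<mu>" unfolding \<mu>_def
    by (rule prob_space.prob_space_distr[OF _ f]) (simp add: N_def N.prob_space_axioms)
  have trans: "emeasure \<mu> ((\<lambda>y. a \<oplus>\<^bsub>Zp p\<^esub> y) ` A) = emeasure \<mu> A"
    if a: "a \<in> ?C" and A: "A \<in> sets \<mu>" for a A
  proof -
    let ?S = "\<lambda>z. z \<ominus>\<^bsub>Zp p\<^esub> a"
    have bnd: "0 \<le> (r + a n) mod int p ^ n" "(r + a n) mod int p ^ n < int p ^ n" for r n
      using assms by auto
    have pre: "?S -` Zp_cylinder p n r \<inter> space \<mu> = Zp_cylinder p n ((r + a n) mod int p ^ n)"
      if "0 \<le> r" "r < int p ^ n" for n r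
      using Zp_cylinder_translate[OF _ a that] assms space by simp
    have S: "?S \<in> \<mu> \<rightarrow>\<^sub>M padic_borel p"
      by (rule meas_gen) (use a pre cyl_sets sets space in auto)
    have "distr \<mu> (padic_borel p) ?S = \<mu>"
    proof (rule measure_eqI_generator_eq[OF Zp_cylinders_Int_stable Zp_cylinders_Pow,
          where A = "\<lambda>_. ?C"])
      fix X assume "X \<in> Zp_cylinders p"
      then consider "X = {}" | n r where "X = Zp_cylinder p n r" "0 \<le> r" "r < int p ^ n"
        using cylE by blast
      then show "emeasure (distr \<mu> (padic_borel p) ?S) X = emeasure \<mu> X"
      proof cases
        case 2
        have "emeasure (distr \<mu> (padic_borel p) ?S) X = emeasure \<mu> (?S -` X \<inter> space \<mu>)"
          unfolding 2(1) by (rule emeasure_distr[OF S cyl_sets])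
        then show ?thesis unfolding 2(1) pre[OF 2(2,3)]
          by (simp only: cyl_emeasure[OF 2(2,3)] cyl_emeasure[OF bnd])
      qed simp
    next
      show "range (\<lambda>_. ?C) \<subseteq> Zp_cylinders p"
        using Zp_cylinder_0[of p] by (auto simp: Zp_cylinders_def)
      show "emeasure (distr \<mu> (padic_borel p) ?S) ?C \<noteq> \<infinity>" for i :: nat
        using prob_space.prob_space_distr[OF prob S] prob_space.emeasure_space_1
        by (metis ennreal_one_neq_top infinity_ennreal_def space_distr space_padic_borel)
    qed (simp_all add: sets sets_padic_borel[OF assms])
    moreover have "(\<lambda>y. a \<oplus>\<^bsub>Zp p\<^esub> y) ` A = ?S -` A \<inter> space \<mu>"
    proof -
      have AC: "A \<subseteq> ?C" using sets.sets_into_space[OF A] space by simp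
      have S_add: "?S (a \<oplus>\<^bsub>Zp p\<^esub> y) = y" if "y \<in> ?C" for y
        using that a by (simp add: a_minus_def a_comm[of a] a_assoc r_neg)
      have add_S: "a \<oplus>\<^bsub>Zp p\<^esub> ?S z = z" if "z \<in> ?C" for z
        using that a by (simp add: a_minus_def a_comm[of a] a_assoc l_neg)
      show ?thesis
      proof (intro equalityI subsetI)
        fix z assume "z \<in> (\<lambda>y. a \<oplus>\<^bsub>Zp p\<^esub> y) ` A"
        then obtain y where "y \<in> A" "z = a \<oplus>\<^bsub>Zp p\<^esub> y" by blast
        then show "z \<in> ?S -` A \<inter> space \<mu>" using AC S_add[of y] a space by auto
      next
        fix z assume z: "z \<in> ?S -` A \<inter> space \<mu>"
        then have "z = a \<oplus>\<^bsub>Zp p\<^esub> ?S z" using add_S[of z] space by simp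
        then show "z \<in> (\<lambda>y. a \<oplus>\<^bsub>Zp p\<^esub> y) ` A" using z by blast
      qed
    qed
    ultimately show ?thesis using emeasure_distr[OF S, of A] A sets by simp
  qed
  show ?thesis using prob sets trans unfolding is_Haar_prob_def by blast
qed

end

theory Submission
  imports Defs
begin

text \<open>The set \<open>padic_W p \<psi> B\<close> is a limsup of cylinders centred at the fractions \<open>a/n\<close>. Replacing \<open>a/n\<close> by
  \<open>a/n + 1\<close> keeps the class modulo 1 and at most doubles the height \<open>max a n\<close>, so translation by 1
  maps the set into the one where \<open>\<psi>\<close> is multiplied by a power of \<open>p\<close>. The union over all these
  enlargements is therefore closed under translation by 1, and as the positive integers are dense,
  it has measure 0 or 1. By a density argument (Cassels) multiplying all radii by a constant changes
  a limsup of shrinking cylinders only by a null set. If the radii do not shrink, then the set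
  is empty or everything, because one admissible fraction \<open>a/n\<close> yields all \<open>a/n + k\<close>.\<close>

section \<open>Sets of finite level and density\<close>

text \<open>These are the finite unions of cylinders of level \<open>d\<close>, described through
  residues alone, so that unions, complements and a change of level need no list of
  representatives.\<close>

definition level_set :: "nat \<Rightarrow> nat \<Rightarrow> (nat \<Rightarrow> int) set \<Rightarrow> bool" where
  "level_set p d S \<longleftrightarrow> S \<subseteq> carrier (Zp p) \<and> (\<forall>x\<in>S. \<forall>y\<in>carrier (Zp p). x d = y d \<longrightarrow> y \<in> S)"

lemma level_set_mono:
  assumes "level_set p d S" "d \<le> e"
  shows "level_set p e S"
  unfolding level_set_def
proof (intro conjI ballI impI)
  show "S \<subseteq> carrier (Zp p)" using assms(1) by (simp add: level_set_def)
  fix x y assume xy: "x \<in> S" "y \<in> carrier (Zp p)" "x e = y e"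
  have "x \<in> carrier (Zp p)" using assms(1) xy(1) by (auto simp: level_set_def)
  then have "x d = y d"
    using xy Zp_compat[OF _ assms(2), of x p] Zp_compat[OF _ assms(2), of y p] by simp
  then show "y \<in> S" using assms(1) xy by (auto simp: level_set_def)
qed

lemma level_set_Un: "level_set p d S \<Longrightarrow> level_set p d T \<Longrightarrow> level_set p d (S \<union> T)"
  unfolding level_set_def by blast

lemma level_set_Compl: "level_set p d S \<Longrightarrow> level_set p d (carrier (Zp p) - S)"
  unfolding level_set_def by (metis Diff_iff Diff_subset subsetD)

lemma level_set_cylinder: "level_set p d (Zp_cylinder p d r)"
  by (auto simp: level_set_def Zp_cylinder_def)

lemma level_set_eq_UN_cylinder:
  assumes "level_set p d S"
  shows "S = (\<Union>r\<in>(\<lambda>x. x d) ` S. Zp_cylinder p d r)"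
  using assms by (fastforce simp: level_set_def Zp_cylinder_def)

text \<open>Invariance is left out at this stage: the approximation and density arguments hold for
  every Borel probability measure on the \<open>p\<close>-adic integers.\<close>

locale Zp_prob = prob_space \<mu> for \<mu> :: "(nat \<Rightarrow> int) measure" +
  fixes p :: nat
  assumes p_gt_1: "p > 1" and sets_mu: "sets \<mu> = sets (padic_borel p)"
begin

lemma space_mu: "space \<mu> = carrier (Zp p)"
  using sets_eq_imp_space_eq[OF sets_mu] space_padic_borel by simp

lemma cylinder_sets [measurable, simp]: "Zp_cylinder p n r \<in> sets \<mu>"
  unfolding sets_mu sets_padic_borel[OF p_gt_1]
  by (rule sigma_sets.Basic) (auto simp: Zp_cylinders_def)

lemma finite_level_residues:
  assumes "level_set p d S"
  shows "finite ((\<lambda>x. x d) ` S)"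
proof (rule finite_subset)
  show "(\<lambda>x. x d) ` S \<subseteq> {0..<int p ^ d}"
  proof clarify
    fix x assume "x \<in> S"
    then have "x \<in> carrier (Zp p)" using assms by (auto simp: level_set_def)
    then show "x d \<in> {0..<int p ^ d}" using Zp_carrierD(1,2) by simp
  qed
qed simp

lemma level_set_sets:
  assumes "level_set p d S"
  shows "S \<in> sets \<mu>"
proof -
  have "(\<Union>r\<in>(\<lambda>x. x d) ` S. Zp_cylinder p d r) \<in> sets \<mu>"
    by (intro sets.finite_UN finite_level_residues[OF assms]) simp
  then show ?thesis by (simp only: level_set_eq_UN_cylinder[OF assms, symmetric])
qed

section \<open>Local bounds and approximation by sets of finite level\<close>

lemma measure_level_set:
  assumes S: "level_set p d S" and N: "N \<in> sets \<mu>"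
  shows "prob (N \<inter> S) = (\<Sum>r\<in>(\<lambda>x. x d) ` S. prob (N \<inter> Zp_cylinder p d r))"
proof -
  have "N \<inter> S = (\<Union>r\<in>(\<lambda>x. x d) ` S. N \<inter> Zp_cylinder p d r)"
    using level_set_eq_UN_cylinder[OF S] by auto
  also have "prob \<dots> = (\<Sum>r\<in>(\<lambda>x. x d) ` S. prob (N \<inter> Zp_cylinder p d r))"
  proof (rule finite_measure_finite_Union[OF finite_level_residues[OF S]])
    show "(\<lambda>r. N \<inter> Zp_cylinder p d r) ` (\<lambda>x. x d) ` S \<subseteq> sets \<mu>" using N by auto
  qed (auto simp: disjoint_family_on_def Zp_cylinder_def)
  finally show ?thesis .
qed

lemma measure_level_set_le:
  assumes S: "level_set p d S" and N: "N \<in> sets \<mu>"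
    and le: "\<And>x. x \<in> S \<Longrightarrow> prob (N \<inter> Zp_cylinder p d (x d)) \<le> \<theta> * prob (Zp_cylinder p d (x d))"
  shows "prob (N \<inter> S) \<le> \<theta> * prob S"
proof -
  have "space \<mu> \<inter> S = S" using S space_mu by (auto simp: level_set_def)
  moreover have "space \<mu> \<inter> Zp_cylinder p d r = Zp_cylinder p d r" for r
    using space_mu by (auto simp: Zp_cylinder_def)
  ultimately have "prob S = (\<Sum>r\<in>(\<lambda>x. x d) ` S. prob (Zp_cylinder p d r))"
    using measure_level_set[OF S sets.top] by (simp only:)
  then show ?thesis using le unfolding measure_level_set[OF S N]
    by (simp only: sum_distrib_left) (intro sum_mono, blast)
qed

text \<open>Cylinders are their own approximations, complements have the same symmetric difference,
  and a countable union is nearly exhausted by a finite one by continuity from below. So the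
  property spreads from the cylinders to the sigma-algebra that they generate.\<close>

lemma level_set_approx:
  assumes "A \<in> sets \<mu>" "\<epsilon> > 0"
  shows "\<exists>d S. level_set p d S \<and> prob (sym_diff A S) < \<epsilon>"
proof -
  \<comment> \<open>Measurability and all \<open>\<epsilon>\<close> belong to the induction
    predicate: the estimates need measurable sets, and a union needs its pieces with error
    \<open>\<epsilon> / 2\<close>.\<close>
  let ?P = "\<lambda>A. A \<in> sets \<mu> \<and> (\<forall>\<epsilon>>0. \<exists>d S. level_set p d S \<and> prob (sym_diff A S) < \<epsilon>)"
  have level: "?P S" if "level_set p d S" for d S
    using that level_set_sets by force
  have un: "?P (A \<union> B)" if A: "?P A" and B: "?P B" for A B
  proof (intro conjI allI impI)
    show "A \<union> B \<in> sets \<mu>" using A B by blast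
    fix \<epsilon> :: real assume "\<epsilon> > 0"
    then obtain d S e T where S: "level_set p d S" "prob (sym_diff A S) < \<epsilon> / 2"
      and T: "level_set p e T" "prob (sym_diff B T) < \<epsilon> / 2"
      using A B half_gt_zero by metis
    have m: "sym_diff A S \<in> sets \<mu>" "sym_diff B T \<in> sets \<mu>"
      using A B level_set_sets S(1) T(1) by auto
    have "prob (sym_diff (A \<union> B) (S \<union> T)) \<le> prob (sym_diff A S \<union> sym_diff B T)"
      using m by (intro finite_measure_mono) auto
    also have "\<dots> \<le> prob (sym_diff A S) + prob (sym_diff B T)"
      by (rule measure_Un_le[OF m])
    finally have "prob (sym_diff (A \<union> B) (S \<union> T)) < \<epsilon>" using S(2) T(2) by simp
    moreover have "level_set p (max d e) (S \<union> T)"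
      using S(1) T(1) level_set_Un level_set_mono max.cobounded1 max.cobounded2 by metis
    ultimately show "\<exists>d S. level_set p d S \<and> prob (sym_diff (A \<union> B) S) < \<epsilon>" by blast
  qed
  have "A \<in> sigma_sets (carrier (Zp p)) (Zp_cylinders p)"
    using assms(1) sets_mu sets_padic_borel[OF p_gt_1] by simp
  then have "?P A"
  proof (induction rule: sigma_sets.induct)
    case (Basic a)
    moreover have "level_set p 0 {}" by (simp add: level_set_def)
    ultimately have "\<exists>d. level_set p d a"
      using level_set_cylinder by (auto simp: Zp_cylinders_def)
    then show ?case using level by blast
  next
    case Empty
    show ?case by (rule level[of 0]) (simp add: level_set_def)
  next
    case (Compl a)
    show ?case
    proof (intro conjI allI impI)
      show "carrier (Zp p) - a \<in> sets \<mu>" using Compl.IH space_mu by (metis sets.compl_sets)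
      fix \<epsilon> :: real assume "\<epsilon> > 0"
      then obtain d S where S: "level_set p d S" "prob (sym_diff a S) < \<epsilon>" using Compl.IH by blast
      have "a \<subseteq> carrier (Zp p)" "S \<subseteq> carrier (Zp p)"
        using Compl.IH sets.sets_into_space[of a \<mu>] space_mu S(1) by (auto simp: level_set_def)
      then have "sym_diff (carrier (Zp p) - a) (carrier (Zp p) - S) = sym_diff a S" by blast
      then show "\<exists>d S. level_set p d S \<and> prob (sym_diff (carrier (Zp p) - a) S) < \<epsilon>"
        using S level_set_Compl by metis
    qed
  next
    case (Union a)
    define b where "b = (\<lambda>n. \<Union>i<n. a i)"
    have b: "?P (b n)" for n
    proof (induction n)
      case 0
      show ?case by (rule level[of 0]) (simp add: level_set_def b_def)
    next
      case (Suc n)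
      have "b (Suc n) = b n \<union> a n" by (auto simp: b_def less_Suc_eq)
      then show ?case using un[OF Suc Union.IH[of n]] by simp
    qed
    have U: "(\<Union>n. b n) = (\<Union>i. a i)" by (auto simp: b_def)
    have meas: "(\<Union>i. a i) \<in> sets \<mu>" using Union.IH by blast
    have lim: "(\<lambda>n. prob (b n)) \<longlonglongrightarrow> prob (\<Union>i. a i)"
      unfolding U[symmetric]
    proof (rule finite_Lim_measure_incseq)
      show "range b \<subseteq> sets \<mu>" using b by blast
      show "incseq b" by (force simp: incseq_def b_def)
    qed
    show ?case
    proof (intro conjI allI impI)
      show "(\<Union>i. a i) \<in> sets \<mu>" by (rule meas)
      fix \<epsilon> :: real assume eps: "\<epsilon> > 0"
      then have "eventually (\<lambda>n. prob (b n) > prob (\<Union>i. a i) - \<epsilon> / 2) sequentially"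
        by (intro order_tendstoD[OF lim]) simp
      then obtain n where n: "prob (b n) > prob (\<Union>i. a i) - \<epsilon> / 2"
        by (auto simp: eventually_sequentially)
      obtain d S where S: "level_set p d S" "prob (sym_diff (b n) S) < \<epsilon> / 2"
        using b[of n] eps half_gt_zero by metis
      have bU: "b n \<subseteq> (\<Union>i. a i)" by (auto simp: b_def)
      have m: "sym_diff (b n) S \<in> sets \<mu>" "(\<Union>i. a i) - b n \<in> sets \<mu>"
        using b[of n] level_set_sets[OF S(1)] meas by auto
      have "prob (sym_diff (\<Union>i. a i) S) \<le> prob (((\<Union>i. a i) - b n) \<union> sym_diff (b n) S)"
        using m bU by (intro finite_measure_mono) auto
      also have "\<dots> \<le> prob ((\<Union>i. a i) - b n) + prob (sym_diff (b n) S)"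
        by (rule measure_Un_le[OF m(2,1)])
      also have "prob ((\<Union>i. a i) - b n) = prob (\<Union>i. a i) - prob (b n)"
        using b[of n] meas bU by (intro finite_measure_Diff) auto
      finally show "\<exists>d S. level_set p d S \<and> prob (sym_diff (\<Union>i. a i) S) < \<epsilon>"
        using n S by (intro exI[of _ d] exI[of _ S]) auto
    qed
  qed
  then show ?thesis using assms(2) by blast
qed

text \<open>A set \<open>S\<close> of finite level close to \<open>N\<close> is close to
  \<open>N \<inter> S\<close> as well, so the inequality passes to the limit \<open>S = N\<close>.
  For \<open>\<theta> < 1\<close> it makes \<open>N\<close> null; for
  \<open>\<theta> = prob N\<close> it gives a zero-one law.\<close>

lemma measure_le_mult_self:
  assumes N: "N \<in> sets \<mu>" and "0 \<le> \<theta>"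
    and le: "\<And>d S. level_set p d S \<Longrightarrow> prob (N \<inter> S) \<le> \<theta> * prob S"
  shows "prob N \<le> \<theta> * prob N"
proof (rule field_le_epsilon)
  fix e :: real assume e: "e > 0"
  \<comment> \<open>The error of the approximation enters once through \<open>N\<close> and
    \<open>\<theta>\<close> times through \<open>S\<close>.\<close>
  define \<epsilon> where "\<epsilon> = e / (1 + \<theta>)"
  have eps: "\<epsilon> > 0" "\<epsilon> * (1 + \<theta>) = e" using e assms(2) by (auto simp: \<epsilon>_def)
  obtain d S where S: "level_set p d S" "prob (sym_diff N S) < \<epsilon>"
    using level_set_approx[OF N eps(1)] by blast
  have m: "S \<in> sets \<mu>" "sym_diff N S \<in> sets \<mu>" using S(1) level_set_sets N by auto
  have "prob N \<le> prob ((N \<inter> S) \<union> sym_diff N S)"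
    using m N by (intro finite_measure_mono) auto
  also have "\<dots> \<le> prob (N \<inter> S) + prob (sym_diff N S)"
    using m N by (intro measure_Un_le) auto
  finally have 1: "prob N \<le> \<theta> * prob S + \<epsilon>" using le[OF S(1)] S(2) by simp
  have "prob S \<le> prob (N \<union> sym_diff N S)"
    using m N by (intro finite_measure_mono) auto
  also have "\<dots> \<le> prob N + prob (sym_diff N S)"
    using m N by (intro measure_Un_le) auto
  finally have "prob S \<le> prob N + \<epsilon>" using S(2) by simp
  then have "\<theta> * prob S \<le> \<theta> * (prob N + \<epsilon>)" using assms(2) by (rule mult_left_mono)
  then show "prob N \<le> \<theta> * prob N + e" using 1 eps(2) by (simp add: algebra_simps)
qed

text \<open>Cut \<open>N\<close> at each point at the first level where it is thin.\<close>

lemma density_null: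
  assumes N: "N \<in> sets \<mu>" and th: "0 \<le> \<theta>" "\<theta> < 1"
    and thin: "\<And>x d0. x \<in> N \<Longrightarrow>
      \<exists>d\<ge>d0. prob (N \<inter> Zp_cylinder p d (x d)) \<le> \<theta> * prob (Zp_cylinder p d (x d))"
  shows "prob N = 0"
proof -
  let ?bad = "\<lambda>d x. prob (N \<inter> Zp_cylinder p d (x d)) \<le> \<theta> * prob (Zp_cylinder p d (x d))"
  have "prob N \<le> \<theta> * prob N"
  proof (rule measure_le_mult_self[OF N th(1)])
    fix e S assume S: "level_set p e S"
    \<comment> \<open>\<open>T d\<close> is cut out of \<open>S\<close>, not out of
      \<open>N\<close>, and levels are counted from \<open>e\<close>: then membership depends only
      on the residue at level \<open>e + d\<close>, and the bound on single cylinders can be summed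
      over \<open>T d\<close>.\<close>
    define T where "T = (\<lambda>d. {x \<in> S. ?bad (e + d) x \<and> (\<forall>d'<d. \<not> ?bad (e + d') x)})"
    have T: "level_set p (e + d) (T d)" for d
      unfolding level_set_def
    proof (intro conjI ballI impI)
      show "T d \<subseteq> carrier (Zp p)" using S by (auto simp: T_def level_set_def)
      fix x y assume xy: "x \<in> T d" "y \<in> carrier (Zp p)" "x (e + d) = y (e + d)"
      have "x \<in> carrier (Zp p)" using xy S by (auto simp: T_def level_set_def)
      then have "x i = y i" if "i \<le> e + d" for i
        using xy Zp_compat[OF _ that, of x p] Zp_compat[OF _ that, of y p] by simp
      moreover have "y \<in> S" using xy level_set_mono[OF S, of "e + d"]
        by (auto simp: T_def level_set_def)
      ultimately show "y \<in> T d" using xy(1) by (auto simp: T_def)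
    qed
    have disj: "disjoint_family T"
      unfolding disjoint_family_on_def
    proof (intro ballI impI)
      fix m n :: nat assume "m \<noteq> n"
      then show "T m \<inter> T n = {}" by (cases "m < n") (auto simp: T_def)
    qed
    have cover: "N \<inter> S = (\<Union>d. N \<inter> T d)"
    proof (intro equalityI subsetI)
      fix x assume x: "x \<in> N \<inter> S"
      then obtain d where "d \<ge> e" "?bad d x" using thin[of x e] by auto
      then have ex: "?bad (e + (d - e)) x" by simp
      let ?d = "LEAST d. ?bad (e + d) x"
      have "?bad (e + ?d) x" using LeastI[of "\<lambda>d. ?bad (e + d) x", OF ex] .
      moreover have "\<forall>d'<?d. \<not> ?bad (e + d') x" using not_less_Least by blast
      ultimately have "x \<in> T ?d" using x by (simp add: T_def)
      then show "x \<in> (\<Union>d. N \<inter> T d)" using x by blast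
    qed (auto simp: T_def)
    have s1: "(\<lambda>d. prob (N \<inter> T d)) sums prob (\<Union>d. N \<inter> T d)"
      using N level_set_sets[OF T] disj
      by (intro finite_measure_UNION) (auto simp: disjoint_family_on_def)
    have s2: "(\<lambda>d. prob (T d)) sums prob (\<Union>d. T d)"
      using level_set_sets[OF T] disj by (intro finite_measure_UNION) auto
    have "prob (N \<inter> S) \<le> \<theta> * prob (\<Union>d. T d)"
      unfolding cover
    proof (rule sums_le[OF _ s1 sums_mult[OF s2]])
      show "prob (N \<inter> T d) \<le> \<theta> * prob (T d)" for d
        by (rule measure_level_set_le[OF T N]) (simp add: T_def)
    qed
    also have "\<dots> \<le> \<theta> * prob S"
      using level_set_sets[OF S] th(1)
      by (intro mult_left_mono finite_measure_mono) (auto simp: T_def)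
    finally show "prob (N \<inter> S) \<le> \<theta> * prob S" .
  qed
  then have "(1 - \<theta>) * prob N \<le> 0" by (simp add: algebra_simps)
  then show ?thesis using th measure_nonneg[of \<mu> N] by (auto simp: mult_le_0_iff)
qed

end

section \<open>Translation by one and limsup sets\<close>

locale Zp_haar = Zp_prob +
  assumes trans_inv: "x \<in> carrier (Zp p) \<Longrightarrow> A \<in> sets \<mu> \<Longrightarrow>
    emeasure \<mu> ((\<lambda>y. x \<oplus>\<^bsub>Zp p\<^esub> y) ` A) = emeasure \<mu> A"
begin

lemma add_one_apply: "(\<one>\<^bsub>Zp p\<^esub> \<oplus>\<^bsub>Zp p\<^esub> x) n = (x n + 1) mod int p ^ n"
  by (simp add: Zp_def mod_add_left_eq add.commute[of 1])

lemma add_one_carrier: "x \<in> carrier (Zp p) \<Longrightarrow> \<one>\<^bsub>Zp p\<^esub> \<oplus>\<^bsub>Zp p\<^esub> x \<in> carrier (Zp p)"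
proof -
  interpret cring "Zp p" using Zp_cring p_gt_1 by simp
  show "x \<in> carrier (Zp p) \<Longrightarrow> \<one>\<^bsub>Zp p\<^esub> \<oplus>\<^bsub>Zp p\<^esub> x \<in> carrier (Zp p)" by simp
qed

text \<open>Translation by one preserves measure and carries the part of \<open>V\<close> in one
  residue class into the part in the next class. The classes form a cycle, so inclusion of
  \<open>V + 1\<close> in \<open>V\<close> already forces all \<open>p ^ n\<close> classes to hold
  equal shares of \<open>V\<close>.\<close>

lemma measure_cylinder_invariant:
  assumes V: "V \<in> sets \<mu>" and closed: "\<And>x. x \<in> V \<Longrightarrow> \<one>\<^bsub>Zp p\<^esub> \<oplus>\<^bsub>Zp p\<^esub> x \<in> V"
    and r: "0 \<le> r" "r < int p ^ n"
  shows "prob (V \<inter> Zp_cylinder p n r) = prob V / real p ^ n"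
proof -
  \<comment> \<open>\<open>f\<close> is increasing and has period \<open>p ^ n\<close>, hence constant.\<close>
  define f where "f = (\<lambda>k. prob (V \<inter> Zp_cylinder p n (int k mod int p ^ n)))"
  have "f k \<le> f (Suc k)" for k
  proof -
    interpret cring "Zp p" using Zp_cring p_gt_1 by simp
    have "\<one>\<^bsub>Zp p\<^esub> \<in> carrier (Zp p)" by (rule one_closed)
    then have "f k = measure \<mu> ((\<lambda>y. \<one>\<^bsub>Zp p\<^esub> \<oplus>\<^bsub>Zp p\<^esub> y) ` (V \<inter> Zp_cylinder p n (int k mod int p ^ n)))"
      unfolding f_def using trans_inv[of "\<one>\<^bsub>Zp p\<^esub>"] V by (simp add: measure_def)
    also have "\<dots> \<le> f (Suc k)" unfolding f_def
    proof (rule finite_measure_mono)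
      show "(\<lambda>y. \<one>\<^bsub>Zp p\<^esub> \<oplus>\<^bsub>Zp p\<^esub> y) ` (V \<inter> Zp_cylinder p n (int k mod int p ^ n))
        \<subseteq> V \<inter> Zp_cylinder p n (int (Suc k) mod int p ^ n)"
        using closed add_one_carrier by (auto simp: Zp_cylinder_def add_one_apply mod_add_left_eq add.commute[of 1])
    qed (use V in auto)
    finally show ?thesis .
  qed
  then have mono: "f i \<le> f j" if "i \<le> j" for i j using that by (rule lift_Suc_mono_le)
  have const: "f k = f 0" if "k < p ^ n" for k
  proof -
    have "f (p ^ n) = f 0" by (simp add: f_def)
    then show ?thesis using mono[of 0 k] mono[of k "p ^ n"] that by simp
  qed
  have "V \<inter> carrier (Zp p) = V" using sets.sets_into_space[OF V] space_mu by auto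
  moreover have "carrier (Zp p) = (\<Union>k<p ^ n. Zp_cylinder p n (int k mod int p ^ n))"
  proof -
    have "x \<in> (\<Union>k<p ^ n. Zp_cylinder p n (int k mod int p ^ n))" if x: "x \<in> carrier (Zp p)" for x
    proof -
      have "nat (x n) < p ^ n" "int (nat (x n)) mod int p ^ n = x n"
        using Zp_carrierD[OF x, of n] by (auto simp: nat_less_iff)
      then show ?thesis using x unfolding Zp_cylinder_def
        by (intro UN_I[of "nat (x n)"]) simp_all
    qed
    moreover have "Zp_cylinder p n s \<subseteq> carrier (Zp p)" for s by (auto simp: Zp_cylinder_def)
    ultimately show ?thesis by blast
  qed
  ultimately have "V = (\<Union>k<p ^ n. V \<inter> Zp_cylinder p n (int k mod int p ^ n))" by blast
  then have "prob V = prob (\<Union>k<p ^ n. V \<inter> Zp_cylinder p n (int k mod int p ^ n))" by (rule arg_cong)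
  also have "\<dots> = (\<Sum>k<p ^ n. f k)"
    unfolding f_def
  proof (rule finite_measure_finite_Union)
    show "disjoint_family_on (\<lambda>k. V \<inter> Zp_cylinder p n (int k mod int p ^ n)) {..<p ^ n}"
    proof -
      have "int k mod int p ^ n = int k" if "k < p ^ n" for k
        using that by (metis mod_less of_nat_mod of_nat_power)
      then show ?thesis by (simp add: disjoint_family_on_def Zp_cylinder_def) fastforce
    qed
  qed (use V in auto)
  also have "\<dots> = real p ^ n * f 0" using const by simp
  finally have "f 0 = prob V / real p ^ n" using p_gt_1 by simp
  moreover have "nat r < p ^ n" using r by (simp add: nat_less_iff)
  moreover have "prob (V \<inter> Zp_cylinder p n r) = f (nat r)" using r by (simp add: f_def)
  ultimately show ?thesis using const by simp
qed

lemma measure_cylinder: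
  assumes "0 \<le> r" "r < int p ^ n"
  shows "prob (Zp_cylinder p n r) = 1 / real p ^ n"
proof -
  have "space \<mu> \<inter> Zp_cylinder p n r = Zp_cylinder p n r" by (auto simp: space_mu Zp_cylinder_def)
  then show ?thesis
    using measure_cylinder_invariant[of "space \<mu>", OF _ _ assms] add_one_carrier
      sets.top[of \<mu>] by (simp add: space_mu prob_space[unfolded space_mu])
qed

text \<open>This is ergodicity of translation by one: \<open>V\<close> is independent of every
  cylinder, hence by approximation of itself, which gives
  \<open>prob V \<le> prob V * prob V\<close>.\<close>

lemma zero_one_add_one:
  assumes V: "V \<in> sets \<mu>" and closed: "\<And>x. x \<in> V \<Longrightarrow> \<one>\<^bsub>Zp p\<^esub> \<oplus>\<^bsub>Zp p\<^esub> x \<in> V"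
  shows "prob V \<in> {0, 1}"
proof -
  have "prob V \<le> prob V * prob V"
  proof (rule measure_le_mult_self[OF V measure_nonneg])
    fix d S assume S: "level_set p d S"
    show "prob (V \<inter> S) \<le> prob V * prob S"
    proof (rule measure_level_set_le[OF S V])
      fix x assume "x \<in> S"
      then have "x \<in> carrier (Zp p)" using S by (auto simp: level_set_def)
      then have "0 \<le> x d" "x d < int p ^ d" using Zp_carrierD by auto
      then show "prob (V \<inter> Zp_cylinder p d (x d)) \<le> prob V * prob (Zp_cylinder p d (x d))"
        using measure_cylinder_invariant[OF V closed] measure_cylinder by simp
    qed
  qed
  then have "prob V = 0 \<or> 1 \<le> prob V" using measure_nonneg[of \<mu> V]
    by (metis mult_le_cancel_right1 not_less order_le_less)
  then show ?thesis using prob_le_1[of V] by auto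
qed

section \<open>Limsup sets of cylinders\<close>

lemma limsup_set_sets:
  assumes "countable I" "\<And>i. i \<in> I \<Longrightarrow> A i \<in> sets \<mu>"
  shows "{x \<in> carrier (Zp p). infinite {i \<in> I. x \<in> A i}} \<in> sets \<mu>"
proof -
  \<comment> \<open>A countable \<open>I\<close> has only countably many finite subsets, so lying in
    infinitely many \<open>A i\<close> is a countable intersection of countable unions, without an
    enumeration of \<open>I\<close>.\<close>
  let ?\<F> = "{F. finite F \<and> F \<subseteq> I}"
  have "{x \<in> carrier (Zp p). infinite {i \<in> I. x \<in> A i}}
    = carrier (Zp p) \<inter> (\<Inter>F\<in>?\<F>. \<Union>i\<in>I - F. A i)"
  proof (intro equalityI subsetI)
    fix x assume x: "x \<in> {x \<in> carrier (Zp p). infinite {i \<in> I. x \<in> A i}}"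
    have "\<exists>i\<in>I - F. x \<in> A i" if F: "finite F" for F
    proof (rule ccontr)
      assume "\<not> (\<exists>i\<in>I - F. x \<in> A i)"
      then have "{i \<in> I. x \<in> A i} \<subseteq> F" by blast
      then show False using x finite_subset F by blast
    qed
    then show "x \<in> carrier (Zp p) \<inter> (\<Inter>F\<in>?\<F>. \<Union>i\<in>I - F. A i)" using x by auto
  next
    fix x assume x: "x \<in> carrier (Zp p) \<inter> (\<Inter>F\<in>?\<F>. \<Union>i\<in>I - F. A i)"
    have "infinite {i \<in> I. x \<in> A i}"
    proof
      assume "finite {i \<in> I. x \<in> A i}"
      then have "{i \<in> I. x \<in> A i} \<in> ?\<F>" by simp
      then show False using x by blast
    qed
    then show "x \<in> {x \<in> carrier (Zp p). infinite {i \<in> I. x \<in> A i}}" using x by simp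
  qed
  moreover have "(\<Inter>F\<in>?\<F>. \<Union>i\<in>I - F. A i) \<in> sets \<mu>"
  proof (rule sets.countable_INT')
    show "countable ?\<F>" by (rule countable_Collect_finite_subset[OF assms(1)])
    show "?\<F> \<noteq> {}" by blast
    have "(\<Union>i\<in>I - F. A i) \<in> sets \<mu>" for F
      using assms by (intro sets.countable_UN') (auto intro: countable_subset)
    then show "(\<lambda>F. \<Union>i\<in>I - F. A i) ` ?\<F> \<subseteq> sets \<mu>" by blast
  qed
  ultimately show ?thesis using sets.top[of \<mu>] space_mu by auto
qed

text \<open>A point of \<open>L j\<close> lies in arbitrarily small enlarged cylinders, since
  \<open>fin\<close> sends their levels to infinity. Each contains its original cylinder as a fixed
  proportion; if the exceptional set avoids the original ones, it is thin at arbitrarily deep levels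
  around each of its points.\<close>

lemma limsup_cylinder_enlarge_null:
  fixes c :: "'i \<Rightarrow> nat \<Rightarrow> int" and e :: "'i \<Rightarrow> nat" and j :: nat
  assumes I: "countable I" and c: "\<And>i. i \<in> I \<Longrightarrow> c i \<in> carrier (Zp p)"
    and fin: "\<And>M. finite {i \<in> I. e i \<le> M}"
  defines "L \<equiv> \<lambda>k. {x \<in> carrier (Zp p). infinite {i \<in> I. x (e i - k) = c i (e i - k)}}"
  shows "L j - L 0 \<in> null_sets \<mu>"
proof -
  define C where "C = (\<lambda>k i. Zp_cylinder p (e i - k) (c i (e i - k)))"
  have L: "L k = {x \<in> carrier (Zp p). infinite {i \<in> I. x \<in> C k i}}" for k
  proof -
    have "{i \<in> I. x \<in> C k i} = {i \<in> I. x (e i - k) = c i (e i - k)}" if "x \<in> carrier (Zp p)" for x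
      using that by (auto simp: C_def Zp_cylinder_def)
    then show ?thesis by (auto simp: L_def)
  qed
  have Lsets: "L k \<in> sets \<mu>" for k
    unfolding L by (rule limsup_set_sets[OF I]) (simp add: C_def)
  let ?\<F> = "{F. finite F \<and> F \<subseteq> I}"
  \<comment> \<open>A point outside \<open>L 0\<close> lies in finitely many \<open>C 0 i\<close>
    only. Fixing that finite set \<open>F\<close> of indices yields a set that misses all other
    \<open>C 0 i\<close>.\<close>
  have null: "L j - (\<Union>i\<in>I - F. C 0 i) \<in> null_sets \<mu>" if F: "finite F" for F
  proof -
    define N where "N = L j - (\<Union>i\<in>I - F. C 0 i)"
    have "(\<Union>i\<in>I - F. C 0 i) \<in> sets \<mu>"
      using I by (intro sets.countable_UN') (auto simp: C_def intro: countable_subset)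
    then have N: "N \<in> sets \<mu>" using Lsets by (auto simp: N_def)
    have "prob N = 0"
    \<comment> \<open>The constant is the share of a cylinder of level \<open>d\<close> that remains
      when a cylinder of level \<open>d + j\<close> inside it is removed.\<close>
    proof (rule density_null[OF N, of "1 - 1 / real p ^ j"])
      show "0 \<le> 1 - 1 / real p ^ j" "1 - 1 / real p ^ j < 1" using p_gt_1 by auto
      fix x d0 assume x: "x \<in> N"
      then have xc: "x \<in> carrier (Zp p)" by (simp add: N_def L_def)
      \<comment> \<open>Discarding the indices with \<open>e i \<le> d0 + j\<close> makes the level
        \<open>e i - j\<close> exceed \<open>d0\<close> and keeps the subtraction from being
        truncated.\<close>
      have "infinite ({i \<in> I. x \<in> C j i} - (F \<union> {i \<in> I. e i \<le> d0 + j}))"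
        using x F fin by (intro Diff_infinite_finite) (auto simp: N_def L)
      then obtain i where "i \<in> {i \<in> I. x \<in> C j i} - (F \<union> {i \<in> I. e i \<le> d0 + j})"
        using infinite_imp_nonempty by blast
      then have i: "i \<in> I - F" "x \<in> C j i" "e i > d0 + j" by auto
      define d where "d = e i - j"
      have d: "e i = d + j" "d \<ge> d0" using i(3) by (auto simp: d_def)
      have ci: "c i \<in> carrier (Zp p)" using c i(1) by blast
      have xd: "x d = c i d" using i(2) by (simp add: C_def Zp_cylinder_def d_def)
      have sub: "C 0 i \<subseteq> Zp_cylinder p d (x d)"
      proof
        fix y assume "y \<in> C 0 i"
        then have y: "y \<in> carrier (Zp p)" "y (d + j) = c i (d + j)"
          by (simp_all add: C_def Zp_cylinder_def d(1))
        have "y d = c i d" using Zp_compat[OF y(1) le_add1, of d j] Zp_compat[OF ci le_add1, of d j] y(2) by simp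
        then show "y \<in> Zp_cylinder p d (x d)" using y(1) xd by (simp add: Zp_cylinder_def)
      qed
      have m1: "prob (Zp_cylinder p d (x d)) = 1 / real p ^ d"
        using Zp_carrierD(1,2)[OF xc] by (rule measure_cylinder)
      have m2: "prob (C 0 i) = 1 / real p ^ (d + j)"
        unfolding C_def d using Zp_carrierD(1,2)[OF ci] by (simp add: measure_cylinder)
      have C0: "C 0 i \<in> sets \<mu>" by (simp add: C_def)
      have "prob (N \<inter> Zp_cylinder p d (x d)) \<le> prob (Zp_cylinder p d (x d) - C 0 i)"
        using i(1) C0 by (intro finite_measure_mono) (auto simp: N_def)
      also have "\<dots> = prob (Zp_cylinder p d (x d)) - prob (C 0 i)"
        using sub C0 by (intro finite_measure_Diff) auto
      also have "\<dots> = (1 - 1 / real p ^ j) * prob (Zp_cylinder p d (x d))"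
        unfolding m1 m2 by (simp add: power_add diff_divide_distrib mult.commute)
      finally show "\<exists>d\<ge>d0. prob (N \<inter> Zp_cylinder p d (x d))
          \<le> (1 - 1 / real p ^ j) * prob (Zp_cylinder p d (x d))"
        using d(2) by blast
    qed
    then show ?thesis using N by (simp add: N_def null_sets_def emeasure_eq_measure)
  qed
  have "(\<Union>F\<in>?\<F>. L j - (\<Union>i\<in>I - F. C 0 i)) \<in> null_sets \<mu>"
    using countable_Collect_finite_subset[OF I] null by (intro null_sets_UN') auto
  moreover have "L j - L 0 \<subseteq> (\<Union>F\<in>?\<F>. L j - (\<Union>i\<in>I - F. C 0 i))"
  proof
    fix x assume x: "x \<in> L j - L 0"
    then have "finite {i \<in> I. x \<in> C 0 i}" by (auto simp: L)
    then have "{i \<in> I. x \<in> C 0 i} \<in> ?\<F>" by simp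
    moreover have "x \<in> L j - (\<Union>i\<in>I - {i \<in> I. x \<in> C 0 i}. C 0 i)" using x by blast
    ultimately show "x \<in> (\<Union>F\<in>?\<F>. L j - (\<Union>i\<in>I - F. C 0 i))" by blast
  qed
  ultimately show ?thesis by (rule null_sets_subset[OF _ sets.Diff[OF Lsets Lsets]])
qed

end

section \<open>Approximation by fractions\<close>

text \<open>The condition \<open>\<bar>z\<bar>\<^sub>p < r\<close> says that \<open>z\<close> vanishes modulo \<open>p\<close> to the power \<open>depth p r\<close>; the value is
  junk for \<open>r \<le> 0\<close>.\<close>

definition depth :: "nat \<Rightarrow> real \<Rightarrow> nat" where
  "depth p r = (LEAST m. (1 / real p) ^ m < r)"

lemma depth_less:
  assumes "p > 1" "r > 0"
  shows "(1 / real p) ^ depth p r < r"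
proof -
  obtain n where "(1 / real p) ^ n < r"
    using real_arch_pow_inv[of r "1 / real p"] assms by auto
  then show ?thesis unfolding depth_def by (rule LeastI)
qed

lemma depth_le: "(1 / real p) ^ m < r \<Longrightarrow> depth p r \<le> m"
  unfolding depth_def by (rule Least_le)

lemma depth_antimono:
  assumes "p > 1" "0 < r" "r \<le> s"
  shows "depth p s \<le> depth p r"
  using depth_less[OF assms(1,2)] assms(3) by (intro depth_le) simp

text \<open>The absolute value takes only the value 0 and powers of \<open>1 / p\<close>, so a
  strict bound by \<open>r\<close> is the weak bound by the largest such power below
  \<open>r\<close>. For \<open>r > 1\<close> the depth is 0 and there is no condition.\<close>

lemma padic_abs_less_iff:
  assumes "p > 1" "z \<in> carrier (Zp p)" "r > 0"
  shows "padic_abs p z < r \<longleftrightarrow> z (depth p r) = 0"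
proof
  assume "z (depth p r) = 0"
  then have "padic_abs p z \<le> (1 / real p) ^ depth p r" using padic_abs_le_iff assms by blast
  then show "padic_abs p z < r" using depth_less[OF assms(1,3)] by simp
next
  assume less: "padic_abs p z < r"
  show "z (depth p r) = 0"
  proof (cases "z = \<zero>\<^bsub>Zp p\<^esub>")
    case True
    then show ?thesis by (simp add: Zp_def)
  next
    case False
    then obtain k where k: "padic_abs p z = (1 / real p) ^ k" by (auto simp: padic_abs_def)
    then have "depth p r \<le> k" using less by (intro depth_le) simp
    then have "padic_abs p z \<le> (1 / real p) ^ depth p r"
      unfolding k using assms(1) by (intro power_decreasing) auto
    then show ?thesis using padic_abs_le_iff assms by blast
  qed
qed

lemma padic_linear_form_apply:
  assumes "p > 1" "\<alpha> \<in> carrier (Zp p)"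
  shows "([n] \<cdot>\<^bsub>Zp p\<^esub> \<alpha> \<ominus>\<^bsub>Zp p\<^esub> [a] \<cdot>\<^bsub>Zp p\<^esub> \<one>\<^bsub>Zp p\<^esub>) m = (int n * \<alpha> m - int a) mod int p ^ m"
    and "[n] \<cdot>\<^bsub>Zp p\<^esub> \<alpha> \<ominus>\<^bsub>Zp p\<^esub> [a] \<cdot>\<^bsub>Zp p\<^esub> \<one>\<^bsub>Zp p\<^esub> \<in> carrier (Zp p)"
proof -
  interpret cring "Zp p" using Zp_cring assms(1) by simp
  have c: "[n] \<cdot>\<^bsub>Zp p\<^esub> \<alpha> \<in> carrier (Zp p)" "[a] \<cdot>\<^bsub>Zp p\<^esub> \<one>\<^bsub>Zp p\<^esub> \<in> carrier (Zp p)"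
    using assms(2) by (auto intro: add.nat_pow_closed)
  then show "[n] \<cdot>\<^bsub>Zp p\<^esub> \<alpha> \<ominus>\<^bsub>Zp p\<^esub> [a] \<cdot>\<^bsub>Zp p\<^esub> \<one>\<^bsub>Zp p\<^esub> \<in> carrier (Zp p)" by simp
  have "(int n * \<alpha> m mod int p ^ m - int a * \<one>\<^bsub>Zp p\<^esub> m mod int p ^ m) mod int p ^ m
    = (int n * \<alpha> m - int a) mod int p ^ m"
    by (simp add: Zp_def mod_diff_eq mod_mult_right_eq)
  then show "([n] \<cdot>\<^bsub>Zp p\<^esub> \<alpha> \<ominus>\<^bsub>Zp p\<^esub> [a] \<cdot>\<^bsub>Zp p\<^esub> \<one>\<^bsub>Zp p\<^esub>) m = (int n * \<alpha> m - int a) mod int p ^ m"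
    using Zp_minus[OF _ c, of m] assms(1) by (simp only: Zp_add_pow)
qed

text \<open>The element \<open>c\<close> is \<open>a/n\<close>, which is a \<open>p\<close>-adic
  integer because \<open>n\<close> is a unit modulo every power of \<open>p\<close>. Dividing by
  \<open>n\<close> costs no level, so approximations by \<open>a/n\<close> are exactly cylinders
  around \<open>c\<close>.\<close>

lemma ex_Zp_quotient:
  assumes "prime p" "\<not> p dvd n"
  shows "\<exists>c\<in>carrier (Zp p). \<forall>\<alpha>\<in>carrier (Zp p). \<forall>m. int p ^ m dvd int n * \<alpha> m - int a \<longleftrightarrow> \<alpha> m = c m"
proof -
  have p: "p > 1" using assms(1) prime_gt_1_nat by blast
  have cop: "coprime (int n) (int p ^ m)" for m
    using assms prime_imp_coprime_nat[of p n] by (simp add: coprime_commute)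
  have "\<exists>x. int p ^ m dvd int n * x - 1" for m
  proof -
    obtain u v where "u * int n + v * int p ^ m = 1" using cop[of m] bezout_int[of "int n" "int p ^ m"] by auto
    then have "int n * u - 1 = int p ^ m * (- v)" by (simp add: algebra_simps)
    then show ?thesis by (metis dvd_triv_left)
  qed
  \<comment> \<open>The inverses of \<open>n\<close> are chosen separately at each level;
    compatibility of the resulting residues comes from the uniqueness of quotients modulo
    \<open>p ^ m\<close>.\<close>
  then obtain x where x: "\<And>m. int p ^ m dvd int n * x m - 1" by metis
  define y where "y = (\<lambda>m. int a * x m)"
  have y: "int p ^ m dvd int n * y m - int a" for m
    using dvd_mult[OF x[of m], of "int a"] by (simp add: y_def algebra_simps)
  have uniq: "int p ^ k dvd u - y m \<longleftrightarrow> int p ^ k dvd int n * u - int a" if "k \<le> m" for u k m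
  proof -
    have "int p ^ k dvd int n * y m - int a" using y[of m] le_imp_power_dvd[OF that] dvd_trans by blast
    then have "int p ^ k dvd int n * (u - y m) + (int n * y m - int a) \<longleftrightarrow> int p ^ k dvd int n * (u - y m)"
      by (rule dvd_add_left_iff)
    moreover have "int n * (u - y m) + (int n * y m - int a) = int n * u - int a"
      by (simp add: algebra_simps)
    moreover have "int p ^ k dvd int n * (u - y m) \<longleftrightarrow> int p ^ k dvd u - y m"
      using cop[of k] by (intro coprime_dvd_mult_right_iff) (simp add: coprime_commute)
    ultimately show ?thesis by simp
  qed
  define c where "c = (\<lambda>m. y m mod int p ^ m)"
  have "c \<in> carrier (Zp p)"
    unfolding c_def
  proof (rule Zp_residueI)
    fix m
    have "int p ^ m dvd int n * y (Suc m) - int a" using y[of "Suc m"] by (rule dvd_trans[rotated]) simp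
    then show "y (Suc m) mod int p ^ m = y m mod int p ^ m" using uniq[of m m] by (simp add: mod_eq_dvd_iff)
  qed (use p in simp)
  moreover have "int p ^ m dvd int n * \<alpha> m - int a \<longleftrightarrow> \<alpha> m = c m" if "\<alpha> \<in> carrier (Zp p)" for \<alpha> m
  proof -
    have "\<alpha> m mod int p ^ m = \<alpha> m" using Zp_carrierD[OF that, of m] by simp
    then have "\<alpha> m = c m \<longleftrightarrow> int p ^ m dvd \<alpha> m - y m" by (simp add: c_def flip: mod_eq_dvd_iff)
    then show ?thesis using uniq[of m m] by simp
  qed
  ultimately show ?thesis by blast
qed

section \<open>Admissible fractions and widened approximation sets\<close>

definition padic_fracs :: "nat \<Rightarrow> real set set \<Rightarrow> (nat \<times> nat) set" where
  "padic_fracs p B = {(a, n). (a, n) \<in> padic_F p B n}"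

lemma padic_fracs_iff:
  "(a, n) \<in> padic_fracs p B \<longleftrightarrow> a > 0 \<and> n > 0 \<and> coprime a n \<and> \<not> p dvd n \<and> mod1 (real a / real n) \<in> B"
  by (auto simp: padic_fracs_def padic_F_def)

lemma mod1_add_int: "mod1 (x + of_int k) = mod1 x"
proof -
  have "x + of_int k - y \<in> \<int> \<longleftrightarrow> x - y \<in> \<int>" for y
    using Ints_add[of "x - y" "of_int k"] Ints_diff[of "x + of_int k - y" "of_int k"] Ints_of_int[of k]
    by (auto simp: algebra_simps)
  then show ?thesis by (simp add: mod1_def mod1_rel_def Image_def)
qed

lemma padic_fracs_shift:
  assumes "(a, n) \<in> padic_fracs p B"
  shows "(a + k * n, n) \<in> padic_fracs p B"
proof -
  have n: "n > 0" using assms by (simp add: padic_fracs_iff)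
  then have "real (a + k * n) / real n = real a / real n + of_int (int k)" by (simp add: field_simps)
  then have "mod1 (real (a + k * n) / real n) = mod1 (real a / real n)" by (simp only: mod1_add_int)
  moreover have "coprime (a + k * n) n \<longleftrightarrow> coprime a n"
    by (metis add.commute coprime_commute coprime_iff_gcd_eq_1 gcd_add_mult)
  ultimately show ?thesis using assms unfolding padic_fracs_iff by auto
qed

text \<open>The analogue of \<open>padic_W\<close> with \<open>\<psi>\<close> multiplied by \<open>p ^ j\<close>; the truncated subtraction is harmless
  because modulo \<open>p ^ 0\<close> there is no condition.\<close>

definition padic_wide :: "nat \<Rightarrow> (real \<Rightarrow> real) \<Rightarrow> real set set \<Rightarrow> nat \<Rightarrow> (nat \<Rightarrow> int) set" where
  "padic_wide p \<psi> B j = {\<alpha> \<in> carrier (Zp p). infinite {(a, n). (a, n) \<in> padic_fracs p B \<and>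
     int p ^ (depth p (\<psi> (max (real a) (real n))) - j)
       dvd int n * \<alpha> (depth p (\<psi> (max (real a) (real n))) - j) - int a}}"

lemma padic_W_eq_wide:
  assumes "p > 1" "\<And>x. x > 0 \<Longrightarrow> \<psi> x > 0"
  shows "padic_W p \<psi> B = padic_wide p \<psi> B 0"
proof -
  have "(a, n) \<in> padic_F p B n \<and>
      padic_abs p ([n] \<cdot>\<^bsub>Zp p\<^esub> \<alpha> \<ominus>\<^bsub>Zp p\<^esub> [a] \<cdot>\<^bsub>Zp p\<^esub> \<one>\<^bsub>Zp p\<^esub>) < \<psi> (max (real a) (real n)) \<longleftrightarrow>
      (a, n) \<in> padic_fracs p B \<and> int p ^ (depth p (\<psi> (max (real a) (real n))) - 0)
       dvd int n * \<alpha> (depth p (\<psi> (max (real a) (real n))) - 0) - int a"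
    if \<alpha>: "\<alpha> \<in> carrier (Zp p)" for \<alpha> a n
  proof (cases "(a, n) \<in> padic_fracs p B")
    case True
    then have "\<psi> (max (real a) (real n)) > 0" by (intro assms(2)) (auto simp: padic_fracs_iff)
    from padic_abs_less_iff[OF assms(1) padic_linear_form_apply(2)[OF assms(1) \<alpha>] this]
    show ?thesis
      using True unfolding padic_linear_form_apply(1)[OF assms(1) \<alpha>] mod_eq_0_iff_dvd padic_fracs_def
      by simp
  qed (simp add: padic_fracs_def)
  then show ?thesis unfolding padic_W_def padic_wide_def by (simp only: cong: conj_cong)
qed

text \<open>Only finitely many pairs have bounded height. In this form infinitude survives a map of
  pairs that does not lower the height, even when small heights must be skipped.\<close>

lemma infinite_nat_pairs_iff:
  fixes S :: "(nat \<times> nat) set"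
  shows "infinite S \<longleftrightarrow> (\<forall>k. \<exists>a n. (a, n) \<in> S \<and> k < max a n)"
proof
  assume inf: "infinite S"
  show "\<forall>k. \<exists>a n. (a, n) \<in> S \<and> k < max a n"
  proof (rule allI, rule ccontr)
    fix k assume "\<nexists>a n. (a, n) \<in> S \<and> k < max a n"
    then have "S \<subseteq> {..k} \<times> {..k}" by (auto simp: not_less)
    then show False using inf finite_subset by blast
  qed
next
  assume unb: "\<forall>k. \<exists>a n. (a, n) \<in> S \<and> k < max a n"
  show "infinite S"
  proof
    assume "finite S"
    then have "finite ((\<lambda>(a, n). max a n) ` S)" by simp
    then obtain k where "\<And>x. x \<in> (\<lambda>(a, n). max a n) ` S \<Longrightarrow> x \<le> k"
      by (meson Max_ge)
    then show False using unb by (metis (mono_tags, lifting) case_prod_conv image_eqI not_less)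
  qed
qed

text \<open>If \<open>a/n\<close> approximates \<open>\<alpha>\<close>, then
  \<open>(a + n)/n\<close> approximates \<open>\<alpha> + 1\<close>. The height at most doubles, so
  \<open>\<psi>\<close> loses at most the factor \<open>c\<close>; this costs \<open>J\<close>
  levels, the same number for every \<open>j\<close>.\<close>

lemma padic_wide_add_one:
  assumes p: "p > 1" and pos: "\<And>x. x > 0 \<Longrightarrow> \<psi> x > 0" and anti: "antimono_on {0<..} \<psi>"
    and "c > 0" and doubling: "\<forall>\<^sub>F n :: nat in sequentially. \<psi> (2 * real n) > c * \<psi> (real n)"
  shows "\<exists>J. \<forall>j. \<forall>\<alpha>\<in>padic_wide p \<psi> B j. \<one>\<^bsub>Zp p\<^esub> \<oplus>\<^bsub>Zp p\<^esub> \<alpha> \<in> padic_wide p \<psi> B (j + J)"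
proof -
  interpret cring "Zp p" using Zp_cring p by simp
  \<comment> \<open>\<open>J\<close> turns the real factor \<open>c\<close> into a power of
    \<open>p\<close>, that is, into a number of levels.\<close>
  obtain J where J: "(1 / real p) ^ J < c"
    using real_arch_pow_inv[of c "1 / real p"] assms by auto
  obtain N where N: "\<And>n. n \<ge> N \<Longrightarrow> \<psi> (2 * real n) > c * \<psi> (real n)"
    using doubling by (auto simp: eventually_sequentially)
  have depth2: "depth p (\<psi> (2 * real h)) \<le> depth p (\<psi> (real h)) + J" if h: "h \<ge> N" "h > 0" for h
  proof (rule depth_le)
    have pos_h: "\<psi> (real h) > 0" using h pos by simp
    have "(1 / real p) ^ (depth p (\<psi> (real h)) + J) \<le> \<psi> (real h) * c"
      unfolding power_add using depth_less[OF p pos_h] J pos_h \<open>c > 0\<close> by (intro mult_mono) auto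
    also have "\<dots> < \<psi> (2 * real h)" using N[OF h(1)] by (simp add: mult.commute)
    finally show "(1 / real p) ^ (depth p (\<psi> (real h)) + J) < \<psi> (2 * real h)" .
  qed
  have "\<one>\<^bsub>Zp p\<^esub> \<oplus>\<^bsub>Zp p\<^esub> \<alpha> \<in> padic_wide p \<psi> B (j + J)" if \<alpha>: "\<alpha> \<in> padic_wide p \<psi> B j" for \<alpha> j
  proof -
    have \<alpha>c: "\<alpha> \<in> carrier (Zp p)" using \<alpha> by (simp add: padic_wide_def)
    then have \<beta>c: "\<one>\<^bsub>Zp p\<^esub> \<oplus>\<^bsub>Zp p\<^esub> \<alpha> \<in> carrier (Zp p)" by simp
    have \<beta>: "(\<one>\<^bsub>Zp p\<^esub> \<oplus>\<^bsub>Zp p\<^esub> \<alpha>) m = (\<alpha> m + 1) mod int p ^ m" for m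
      by (simp add: Zp_def mod_add_left_eq add.commute[of 1])
    let ?S = "{(a, n). (a, n) \<in> padic_fracs p B \<and>
      int p ^ (depth p (\<psi> (max (real a) (real n))) - j)
       dvd int n * \<alpha> (depth p (\<psi> (max (real a) (real n))) - j) - int a}"
    let ?T = "{(a, n). (a, n) \<in> padic_fracs p B \<and>
      int p ^ (depth p (\<psi> (max (real a) (real n))) - (j + J))
       dvd int n * (\<one>\<^bsub>Zp p\<^esub> \<oplus>\<^bsub>Zp p\<^esub> \<alpha>) (depth p (\<psi> (max (real a) (real n))) - (j + J)) - int a}"
    have inf: "infinite ?S" using \<alpha> by (simp add: padic_wide_def)
    have "infinite ?T"
      unfolding infinite_nat_pairs_iff
    proof
      fix k
      \<comment> \<open>Height above \<open>N\<close> makes the doubling condition available; height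
        above \<open>k\<close> serves the unboundedness.\<close>
      obtain a n where S: "(a, n) \<in> ?S" and big: "max k N < max a n"
        using inf unfolding infinite_nat_pairs_iff by blast
      then have I: "(a, n) \<in> padic_fracs p B" by simp
      define m where "m = depth p (\<psi> (max (real a) (real n))) - j"
      define m' where "m' = depth p (\<psi> (max (real (a + n)) (real n))) - (j + J)"
      have "m' \<le> m"
      proof -
        have "depth p (\<psi> (max (real (a + n)) (real n))) \<le> depth p (\<psi> (2 * real (max a n)))"
        proof (rule depth_antimono[OF p])
          show "0 < \<psi> (2 * real (max a n))" using big by (intro pos) auto
          show "\<psi> (2 * real (max a n)) \<le> \<psi> (max (real (a + n)) (real n))"
            using I by (intro monotone_onD[OF anti]) (auto simp: padic_fracs_iff)
        qed
        also have "\<dots> \<le> depth p (\<psi> (real (max a n))) + J" using big by (intro depth2) auto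
        finally show ?thesis unfolding m_def m'_def by (simp add: of_nat_max)
      qed
      have dvd: "int p ^ m dvd int n * \<alpha> m - int a" using S by (simp add: m_def)
      then have "int p ^ m' dvd int n * \<alpha> m - int a"
        using le_imp_power_dvd[OF \<open>m' \<le> m\<close>] dvd_trans by blast
      then have "int p ^ m' dvd int n * \<alpha> m' - int a"
      proof -
        have "(int n * \<alpha> m') mod int p ^ m' = (int n * \<alpha> m) mod int p ^ m'"
          using Zp_compat[OF \<alpha>c \<open>m' \<le> m\<close>] by (metis mod_mult_right_eq)
        then show ?thesis using \<open>int p ^ m' dvd int n * \<alpha> m - int a\<close>
          by (metis mod_eq_dvd_iff)
      qed
      moreover have "(int n * (\<one>\<^bsub>Zp p\<^esub> \<oplus>\<^bsub>Zp p\<^esub> \<alpha>) m') mod int p ^ m' = (int n * (\<alpha> m' + 1)) mod int p ^ m'"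
        unfolding \<beta> by (rule mod_mult_right_eq)
      ultimately have "int p ^ m' dvd (int n * \<alpha> m' - int a)
          + (int n * (\<one>\<^bsub>Zp p\<^esub> \<oplus>\<^bsub>Zp p\<^esub> \<alpha>) m' - int n * (\<alpha> m' + 1))"
        unfolding mod_eq_dvd_iff by (rule dvd_add)
      also have "(int n * \<alpha> m' - int a) + (int n * (\<one>\<^bsub>Zp p\<^esub> \<oplus>\<^bsub>Zp p\<^esub> \<alpha>) m' - int n * (\<alpha> m' + 1))
          = int n * (\<one>\<^bsub>Zp p\<^esub> \<oplus>\<^bsub>Zp p\<^esub> \<alpha>) m' - int (a + n)"
        by (simp add: distrib_left)
      finally have "int p ^ m' dvd int n * (\<one>\<^bsub>Zp p\<^esub> \<oplus>\<^bsub>Zp p\<^esub> \<alpha>) m' - int (a + n)" .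
      moreover have "(a + n, n) \<in> padic_fracs p B" using padic_fracs_shift[OF I, of 1] by simp
      ultimately have "(a + n, n) \<in> ?T" unfolding m'_def by simp
      moreover have "k < max (a + n) n" using big by auto
      ultimately show "\<exists>a n. (a, n) \<in> ?T \<and> k < max a n" by blast
    qed
    then show ?thesis using \<beta>c by (simp add: padic_wide_def)
  qed
  then show ?thesis by blast
qed

text \<open>With depth at most \<open>M\<close>, agreement modulo \<open>p ^ M\<close> is good
  enough at every height. A single admissible \<open>a/n\<close> has infinitely many integer shifts
  \<open>a/n + k\<close> congruent to a given \<open>\<alpha>\<close> modulo \<open>p ^ M\<close>,
  and all of them are admissible.\<close>

lemma padic_wide_0_trivial:
  assumes p: "prime p" and bound: "\<And>x. x > 0 \<Longrightarrow> depth p (\<psi> x) \<le> M"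
  shows "padic_wide p \<psi> B 0 = {} \<or> padic_wide p \<psi> B 0 = carrier (Zp p)"
proof (cases "padic_fracs p B = {}")
  case True
  then show ?thesis by (simp add: padic_wide_def)
next
  case False
  then obtain a n where I: "(a, n) \<in> padic_fracs p B" by auto
  then have n: "n > 0" "\<not> p dvd n" by (auto simp: padic_fracs_iff)
  obtain c where c: "c \<in> carrier (Zp p)"
    "\<And>\<alpha> m. \<alpha> \<in> carrier (Zp p) \<Longrightarrow> int p ^ m dvd int n * \<alpha> m - int a \<longleftrightarrow> \<alpha> m = c m"
    using ex_Zp_quotient[OF p n(2), of a] by blast
  have p1: "p > 1" using p prime_gt_1_nat by blast
  have "\<alpha> \<in> padic_wide p \<psi> B 0" if \<alpha>: "\<alpha> \<in> carrier (Zp p)" for \<alpha>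
  proof -
    \<comment> \<open>The values \<open>k t\<close> are natural solutions of
      \<open>c + k = \<alpha>\<close> modulo \<open>p ^ M\<close>; the parameter \<open>t\<close>
      supplies infinitely many.\<close>
    define k where "k = (\<lambda>t. nat ((\<alpha> M - c M) mod int p ^ M) + t * p ^ M)"
    have k: "int p ^ M dvd int n * \<alpha> M - int (a + k t * n)" for t
    proof -
      have "int (k t) = (\<alpha> M - c M) mod int p ^ M + int t * int p ^ M" using p1 by (simp add: k_def)
      then have "int (k t) mod int p ^ M = (\<alpha> M - c M) mod int p ^ M" by simp
      then have "int p ^ M dvd int n * (\<alpha> M - c M - int (k t))"
        by (metis mod_eq_dvd_iff dvd_mult)
      moreover have "int p ^ M dvd int n * c M - int a" using c by blast
      ultimately have "int p ^ M dvd int n * (\<alpha> M - c M - int (k t)) + (int n * c M - int a)"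
        by (rule dvd_add)
      then show ?thesis by (simp add: algebra_simps)
    qed
    let ?S = "{(a, n). (a, n) \<in> padic_fracs p B \<and>
      int p ^ (depth p (\<psi> (max (real a) (real n))) - 0)
       dvd int n * \<alpha> (depth p (\<psi> (max (real a) (real n))) - 0) - int a}"
    have "(a + k t * n, n) \<in> ?S" for t
    proof -
      define m where "m = depth p (\<psi> (max (real (a + k t * n)) (real n)))"
      have "m \<le> M" unfolding m_def using n by (intro bound) auto
      have "(int n * \<alpha> m) mod int p ^ m = (int n * \<alpha> M) mod int p ^ m"
        using Zp_compat[OF \<alpha> \<open>m \<le> M\<close>] by (metis mod_mult_right_eq)
      moreover have "int p ^ m dvd int n * \<alpha> M - int (a + k t * n)"
        using k[of t] le_imp_power_dvd[OF \<open>m \<le> M\<close>] dvd_trans by blast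
      ultimately have "int p ^ m dvd int n * \<alpha> m - int (a + k t * n)" by (metis mod_eq_dvd_iff)
      then show ?thesis using padic_fracs_shift[OF I] by (simp add: m_def)
    qed
    then have "range (\<lambda>t. (a + k t * n, n)) \<subseteq> ?S" by blast
    moreover have "infinite (range (\<lambda>t. (a + k t * n, n)))"
      by (rule range_inj_infinite) (use n p1 in \<open>auto simp: inj_on_def k_def\<close>)
    ultimately have "infinite ?S" using finite_subset by blast
    then show ?thesis using \<alpha> by (simp add: padic_wide_def)
  qed
  moreover have "padic_wide p \<psi> B 0 \<subseteq> carrier (Zp p)" by (auto simp: padic_wide_def)
  ultimately show ?thesis by blast
qed

text \<open>The widened sets are limsup sets of cylinders around the quotients \<open>a/n\<close>.
  As \<open>\<psi>\<close> decreases, one point \<open>x\<close> of depth above \<open>M\<close>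
  forces all pairs of height at least \<open>x\<close> to have depth above \<open>M\<close>; this
  leaves finitely many pairs of depth at most \<open>M\<close>, as the enlargement lemma
  demands.\<close>

lemma (in Zp_haar) padic_wide_null:
  assumes p: "prime p" and pos: "\<And>x. x > 0 \<Longrightarrow> \<psi> x > 0" and anti: "antimono_on {0<..} \<psi>"
    and unbounded: "\<And>M. \<exists>x>0. depth p (\<psi> x) > M"
  shows "padic_wide p \<psi> B j \<in> sets \<mu>"
    and "padic_wide p \<psi> B j - padic_wide p \<psi> B 0 \<in> null_sets \<mu>"
proof -
  define e where "e = (\<lambda>(a, n). depth p (\<psi> (max (real a) (real n))))"
  have "\<exists>c. c \<in> carrier (Zp p) \<and> (\<forall>\<alpha>\<in>carrier (Zp p). \<forall>m.
      int p ^ m dvd int (snd i) * \<alpha> m - int (fst i) \<longleftrightarrow> \<alpha> m = c m)" if "i \<in> padic_fracs p B" for i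
  proof -
    have "\<not> p dvd snd i" using that by (cases i) (simp add: padic_fracs_iff)
    from ex_Zp_quotient[OF p this, of "fst i"] show ?thesis by blast
  qed
  then have "\<exists>c. \<forall>i\<in>padic_fracs p B. c i \<in> carrier (Zp p) \<and> (\<forall>\<alpha>\<in>carrier (Zp p). \<forall>m.
      int p ^ m dvd int (snd i) * \<alpha> m - int (fst i) \<longleftrightarrow> \<alpha> m = c i m)"
    by (intro bchoice) blast
  \<comment> \<open>For \<open>i = (a, n)\<close> the centre \<open>c i\<close> is the
    \<open>p\<close>-adic integer \<open>a/n\<close>.\<close>
  then obtain c where c: "\<And>i. i \<in> padic_fracs p B \<Longrightarrow> c i \<in> carrier (Zp p)"
    "\<And>i \<alpha> m. i \<in> padic_fracs p B \<Longrightarrow> \<alpha> \<in> carrier (Zp p) \<Longrightarrow>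
      int p ^ m dvd int (snd i) * \<alpha> m - int (fst i) \<longleftrightarrow> \<alpha> m = c i m"
    by blast
  have wide: "padic_wide p \<psi> B k
    = {\<alpha> \<in> carrier (Zp p). infinite {i \<in> padic_fracs p B. \<alpha> (e i - k) = c i (e i - k)}}" for k
  proof -
    have "{(a, n). (a, n) \<in> padic_fracs p B \<and>
        int p ^ (depth p (\<psi> (max (real a) (real n))) - k)
         dvd int n * \<alpha> (depth p (\<psi> (max (real a) (real n))) - k) - int a}
      = {i \<in> padic_fracs p B. \<alpha> (e i - k) = c i (e i - k)}" if \<alpha>: "\<alpha> \<in> carrier (Zp p)" for \<alpha>
    proof (rule Set.set_eqI)
      fix i :: "nat \<times> nat"
      obtain a n where i: "i = (a, n)" by (cases i)
      show "i \<in> {(a, n). (a, n) \<in> padic_fracs p B \<and>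
        int p ^ (depth p (\<psi> (max (real a) (real n))) - k)
         dvd int n * \<alpha> (depth p (\<psi> (max (real a) (real n))) - k) - int a} \<longleftrightarrow>
        i \<in> {i \<in> padic_fracs p B. \<alpha> (e i - k) = c i (e i - k)}"
        using c(2)[OF _ \<alpha>, of i "e i - k"] by (cases "i \<in> padic_fracs p B") (simp_all add: i e_def)
    qed
    then show ?thesis unfolding padic_wide_def by (simp only: cong: conj_cong)
  qed
  have "finite {i \<in> padic_fracs p B. e i \<le> M}" for M
  proof -
    obtain x where x: "x > 0" "depth p (\<psi> x) > M" using unbounded by blast
    have "max a n \<le> nat \<lceil>x\<rceil>" if i: "(a, n) \<in> padic_fracs p B" "e (a, n) \<le> M" for a n
    proof (rule ccontr)
      assume "\<not> max a n \<le> nat \<lceil>x\<rceil>"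
      then have "x \<le> max (real a) (real n)" by linarith
      then have "\<psi> (max (real a) (real n)) \<le> \<psi> x"
        using x(1) by (intro monotone_onD[OF anti]) auto
      moreover have "0 < \<psi> (max (real a) (real n))"
        using i by (intro pos) (auto simp: padic_fracs_iff)
      ultimately have "depth p (\<psi> x) \<le> e (a, n)"
        unfolding e_def case_prod_conv using depth_antimono[OF p_gt_1] by blast
      then show False using x(2) i(2) by simp
    qed
    then have "{i \<in> padic_fracs p B. e i \<le> M} \<subseteq> {..nat \<lceil>x\<rceil>} \<times> {..nat \<lceil>x\<rceil>}"
      by (intro subsetI) (metis (mono_tags, lifting) SigmaI atMost_iff max.boundedE mem_Collect_eq surj_pair)
    then show ?thesis by (rule finite_subset) simp
  qed
  then show "padic_wide p \<psi> B j - padic_wide p \<psi> B 0 \<in> null_sets \<mu>"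
    unfolding wide by (intro limsup_cylinder_enlarge_null c(1)) auto
  have "padic_wide p \<psi> B j
    = {\<alpha> \<in> carrier (Zp p). infinite {i \<in> padic_fracs p B. \<alpha> \<in> Zp_cylinder p (e i - j) (c i (e i - j))}}"
    unfolding wide by (intro Collect_cong conj_cong refl) (simp add: Zp_cylinder_def)
  also have "\<dots> \<in> sets \<mu>" by (rule limsup_set_sets) auto
  finally show "padic_wide p \<psi> B j \<in> sets \<mu>" .
qed

section \<open>The zero-one law\<close>

theorem mainTheorem5:
  fixes p :: nat and B :: "real set set" and \<psi> :: "real \<Rightarrow> real" and \<mu> :: "(nat \<Rightarrow> int) measure"
  assumes "prime p"
    and "is_Haar_prob p \<mu>"
    and "is_RmodZ_ball B"
    and "\<And>x. x > 0 \<Longrightarrow> \<psi> x > 0"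
    and "antimono_on {0<..} \<psi>"
    and "\<And>s. s > 1 \<Longrightarrow> \<exists>c>0. \<forall>\<^sub>F n :: nat in sequentially. \<psi> (s * real n) > c * \<psi> (real n)"
  shows "padic_W p \<psi> B \<in> sets \<mu> \<and> measure \<mu> (padic_W p \<psi> B) \<in> {0, 1}"
proof -
  have p: "p > 1" using assms(1) prime_gt_1_nat by blast
  interpret prob_space \<mu> using assms(2) by (simp add: is_Haar_prob_def)
  interpret Zp_haar \<mu> p
    by unfold_locales (use assms(2) p in \<open>auto simp: is_Haar_prob_def\<close>)
  have W: "padic_W p \<psi> B = padic_wide p \<psi> B 0" by (rule padic_W_eq_wide[OF p assms(4)])
  show ?thesis
  \<comment> \<open>Bounded depth means that \<open>\<psi>\<close> stays above a positive constant;
    the cylinders then do not shrink, and the density argument does not apply.\<close>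
  proof (cases "\<exists>M. \<forall>x>0. depth p (\<psi> x) \<le> M")
    case True
    then have "padic_wide p \<psi> B 0 = {} \<or> padic_wide p \<psi> B 0 = space \<mu>"
      unfolding space_mu using padic_wide_0_trivial[OF assms(1)] by blast
    then show ?thesis using W prob_space by auto
  next
    case False
    then have "\<exists>x>0. depth p (\<psi> x) > M" for M by (metis not_le)
    note wide = padic_wide_null[OF assms(1,4,5) this]
    \<comment> \<open>Translation by one costs \<open>J\<close> levels, which the union over all
      \<open>j\<close> absorbs.\<close>
    define V where "V = (\<Union>j. padic_wide p \<psi> B j)"
    have V: "V \<in> sets \<mu>" unfolding V_def using wide(1) by blast
    \<comment> \<open>The factor 2 is the growth of the height when \<open>a\<close> is replaced by
      \<open>a + n\<close>.\<close>
    obtain c where "c > 0" "\<forall>\<^sub>F n :: nat in sequentially. \<psi> (2 * real n) > c * \<psi> (real n)"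
      using assms(6)[of 2] by auto
    then obtain J where "\<forall>j. \<forall>\<alpha>\<in>padic_wide p \<psi> B j. \<one>\<^bsub>Zp p\<^esub> \<oplus>\<^bsub>Zp p\<^esub> \<alpha> \<in> padic_wide p \<psi> B (j + J)"
      using padic_wide_add_one[OF p assms(4,5)] by blast
    then have "prob V \<in> {0, 1}" by (intro zero_one_add_one[OF V]) (auto simp: V_def)
    \<comment> \<open>\<open>V\<close> exceeds the original set by a countable union of null sets,
      so the two have equal measure.\<close>
    moreover have "prob V = prob (padic_wide p \<psi> B 0)"
    proof -
      have "V - padic_wide p \<psi> B 0 = (\<Union>j. padic_wide p \<psi> B j - padic_wide p \<psi> B 0)"
        by (auto simp: V_def)
      also have "\<dots> \<in> null_sets \<mu>" using wide(2) by (rule null_sets_UN)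
      finally have "V - padic_wide p \<psi> B 0 \<in> null_sets \<mu>" .
      then have "prob (V - padic_wide p \<psi> B 0) = 0" by (simp add: measure_eq_0_null_sets)
      moreover have "padic_wide p \<psi> B 0 \<subseteq> V" by (auto simp: V_def)
      ultimately show ?thesis using finite_measure_Diff[OF V wide(1)[of _ 0]] by simp
    qed
    ultimately show ?thesis using W wide(1) by simp
  qed
qed

end
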